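(* Let $F$ be a natural exponential family on $\mathbb{R}$ and let $\mu$ be an element of $F$ with mean $m_o$. Let $f_\mu(x,m)=\exp\{\psi_\mu(m)x-k_\mu(\psi_\mu(m))\}$ for $x\in\mathbb{R}$, $m\in M_F$, and let $P_n(x)=\frac{\partial^n}{\partial m^n}f_\mu(x,m)\big|_{m=m_o}$ for $n\in\mathbb{N}$. Suppose that $(Q_n)_{n\in\mathbb{N}}$ is a family of $\mu$-$2$-orthogonal polynomials such that $Q_n$ is of degree $n$. Then the generating function of $(Q_n)_{n\in\mathbb{N}}$ is exponential if and only if there exists $t\in\mathbb{R}\setminus\{0\}$ such that, for all $n\in\mathbb{N}$, $$Q_n(x)=t^nP_n(x).$$ In this case, the functions $a$ and $b$ in the exponential form $\sum_{n\in\mathbb{N}}Q_n(x)\frac{z^n}{n!}=\exp\{a(z)x+b(z)\}$ of the generating function are given by $a(z)=\psi_\mu(tz+m_o)$ and $b(z)=-k_\mu(a(z))$.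
   Context: $\mathbb{N}=\{0,1,2,\dots\}$ and $\mathbb{N}^*=\{1,2,\dots\}$. For a positive Radon measure $\nu$ on $\mathbb{R}$, let $L_\nu(\theta)=\int_{\mathbb{R}}\exp(\theta x)\,\nu(dx)\le+\infty$, and let $\Theta(\nu)$ be the interior of $\{\theta\in\mathbb{R}: L_\nu(\theta)<\infty\}$. $\mathcal{M}(\mathbb{R})$ is the set of such $\nu$ with $\Theta(\nu)\neq\emptyset$ and $\nu$ not concentrated on one point. For $\nu\in\mathcal{M}(\mathbb{R})$ put $k_\nu=\log L_\nu$ on $\Theta(\nu)$; it is strictly convex and real analytic. For $\theta\in\Theta(\nu)$ let $P(\theta,\nu)(dx)=\exp(\theta x-k_\nu(\theta))\,\nu(dx)$. The natural exponential family (NEF) generated by $\nu$ is $F=F(\nu)=\{P(\theta,\nu):\theta\in\Theta(\nu)\}$. Its domain of the means is the open interval $M_F=k_\nu'(\Theta(\nu))$, and $\psi_\nu:M_F\to\Theta(\nu)$ is the inverse of $k_\nu'$. Any element $\mu$ of $F$ itself generates $F$ (i.e. $F(\mu)=F$), so $k_\mu$ and $\psi_\mu$ are defined in the same way with $\nu=\mu$; if $\mu$ has mean $m_o$ then $m_o\in M_F$, $0\in\Theta(\mu)$ and $\psi_\mu(m_o)=0$. Each $P_n$ is a polynomial in $x$ of degree $n$. Let $\mu$ be a measure on $\mathbb{R}$ with $\int|x|^n\mu(dx)<\infty$ for all $n\in\mathbb{N}$. A family $(Q_n)_{n\in\mathbb{N}}$ of polynomials on $\mathbb{R}$ is $\mu$-$2$-orthogonal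 if for all $n,q\in\mathbb{N}^*$ one has $\int Q_n(x)Q_q(x)\,\mu(dx)=0$ whenever $n\ge2q$, and $\int Q_n(x)\,\mu(dx)=0$. The generating function of a sequence of real polynomials $(Q_n)_{n\in\mathbb{N}}$ is exponential if there exist $r>0$ and two real analytic functions $a$ and $b$ defined on $]-r,r[$ such that, for all $z\in\,]-r,r[$ and all $x\in\mathbb{R}$, $\sum_{n\in\mathbb{N}}Q_n(x)\frac{z^n}{n!}=\exp\{a(z)x+b(z)\}$.
   Formalization: The normalisation Q_0 = 1 is added: as printed the equivalence fails, e.g. for the standard Gaussian and Q_n = 2He_n, whose generating function is exponential although Q_0 = 2 while t^0 P_0 = 1. *)

theory Defs
  imports "HOL-Analysis.Analysis" "HOL-Computational_Algebra.Polynomial"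
begin

section \<open>Natural exponential families on the real line\<close>

text \<open>On the real line the positive Radon measures are exactly the Borel measures that are
  finite on compact sets.\<close>

definition radon :: "real measure \<Rightarrow> bool" where
  "radon \<nu> \<longleftrightarrow> sets \<nu> = sets borel \<and> (\<forall>K. compact K \<longrightarrow> emeasure \<nu> K < \<infinity>)"

definition laplace :: "real measure \<Rightarrow> real \<Rightarrow> ennreal" where
  "laplace \<nu> \<theta> = (\<integral>\<^sup>+ x. ennreal (exp (\<theta> * x)) \<partial>\<nu>)"

definition Theta :: "real measure \<Rightarrow> real set" where
  "Theta \<nu> = interior {\<theta>. laplace \<nu> \<theta> < \<infinity>}"

text \<open>The last condition also excludes the zero measure.\<close>

definition in_M :: "real measure \<Rightarrow> bool" where
  "in_M \<nu> \<longleftrightarrow> radon \<nu> \<and> Theta \<nu> \<noteq> {} \<and> \<not> (\<exists>c. AE x in \<nu>. x = c)"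

text \<open>The functions \<open>cumulant \<nu>\<close> and \<open>psi \<nu>\<close> below are meaningful only on \<open>Theta \<nu>\<close> and on
  \<open>means_domain \<nu>\<close> respectively; both sets are open, so derivatives taken there do not depend
  on the values elsewhere.\<close>

definition cumulant :: "real measure \<Rightarrow> real \<Rightarrow> real" where
  "cumulant \<nu> \<theta> = ln (enn2real (laplace \<nu> \<theta>))"

definition nef_member :: "real \<Rightarrow> real measure \<Rightarrow> real measure" where
  "nef_member \<theta> \<nu> = density \<nu> (\<lambda>x. ennreal (exp (\<theta> * x - cumulant \<nu> \<theta>)))"

definition nef_generated :: "real measure \<Rightarrow> real measure set" where
  "nef_generated \<nu> = (\<lambda>\<theta>. nef_member \<theta> \<nu>) ` Theta \<nu>"

definition natural_exponential_family :: "real measure set \<Rightarrow> bool" where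
  "natural_exponential_family F \<longleftrightarrow> (\<exists>\<nu>. in_M \<nu> \<and> F = nef_generated \<nu>)"

text \<open>The domain of the means depends only on the family generated by \<open>\<nu>\<close>, so it may be computed
  from any member of the family.\<close>

definition means_domain :: "real measure \<Rightarrow> real set" where
  "means_domain \<nu> = deriv (cumulant \<nu>) ` Theta \<nu>"

definition psi :: "real measure \<Rightarrow> real \<Rightarrow> real" where
  "psi \<nu> = the_inv_into (Theta \<nu>) (deriv (cumulant \<nu>))"

definition nef_density :: "real measure \<Rightarrow> real \<Rightarrow> real \<Rightarrow> real" where
  "nef_density \<mu> x m = exp (psi \<mu> m * x - cumulant \<mu> (psi \<mu> m))"

definition nef_poly :: "real measure \<Rightarrow> real \<Rightarrow> nat \<Rightarrow> real \<Rightarrow> real" where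
  "nef_poly \<mu> m\<^sub>o n x = (deriv ^^ n) (\<lambda>m. nef_density \<mu> x m) m\<^sub>o"


section \<open>2-orthogonality and exponential generating functions\<close>

definition two_orthogonal :: "real measure \<Rightarrow> (nat \<Rightarrow> real poly) \<Rightarrow> bool" where
  "two_orthogonal \<mu> Q \<longleftrightarrow>
     sets \<mu> = sets borel \<and>
     (\<forall>n::nat. integrable \<mu> (\<lambda>x. \<bar>x\<bar> ^ n)) \<and>
     (\<forall>n q. n \<ge> 1 \<longrightarrow> q \<ge> 1 \<longrightarrow> n \<ge> 2 * q \<longrightarrow> (LINT x|\<mu>. poly (Q n) x * poly (Q q) x) = 0) \<and>
     (\<forall>n\<ge>1. (LINT x|\<mu>. poly (Q n) x) = 0)"

text \<open>Intended for open sets \<open>S\<close>: near each point of \<open>S\<close> the function is the sum of a convergent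
  power series.\<close>

definition real_analytic_on :: "(real \<Rightarrow> real) \<Rightarrow> real set \<Rightarrow> bool" where
  "real_analytic_on f S \<longleftrightarrow> (\<forall>x\<in>S. \<exists>A. (\<lambda>h. f (x + h)) has_fps_expansion A)"

definition exponential_form ::
  "(nat \<Rightarrow> real poly) \<Rightarrow> real \<Rightarrow> (real \<Rightarrow> real) \<Rightarrow> (real \<Rightarrow> real) \<Rightarrow> bool" where
  "exponential_form Q r a b \<longleftrightarrow>
     r > 0 \<and> real_analytic_on a {-r<..<r} \<and> real_analytic_on b {-r<..<r} \<and>
     (\<forall>z\<in>{-r<..<r}. \<forall>x. (\<lambda>n. poly (Q n) x * (z ^ n / fact n)) sums exp (a z * x + b z))"

definition exponential_generating_function :: "(nat \<Rightarrow> real poly) \<Rightarrow> bool" where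
  "exponential_generating_function Q \<longleftrightarrow> (\<exists>r a b. exponential_form Q r a b)"

end

theory Submission
  imports Defs "HOL-Complex_Analysis.Complex_Analysis"
begin

text \<open>
  Write \<open>k\<close> for the cumulant function of \<open>\<mu>\<close>, \<open>P\<^sub>\<theta>\<close> for the members of the family, and let
  \<open>k'\<close> and \<open>k''\<close> be their means and variances as functions of \<open>\<theta>\<close>.

  Suppose the generating function is \<open>exp (a z * x + b z)\<close>. Integrating it against a polynomial
  \<open>p\<close> gives, on one side, the \<open>\<mu>\<close>-integral of \<open>p x * exp (a z * x) * exp (b z)\<close>, a combination of
  the derivatives of the Laplace transform at \<open>a z\<close>; on the other side, the power series whose
  coefficients are the integrals of \<open>Q n * p\<close>. By 2-orthogonality this series is a polynomial of
  low degree when \<open>p\<close> is one of the first three \<open>Q n\<close>. For \<open>p = 1\<close> it says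
  \<open>b z = - k (a z)\<close>; for \<open>p = Q 1\<close> it says that \<open>k' (a z)\<close> is affine in \<open>z\<close>, say
  \<open>t * z + m\<^sub>o\<close>, so \<open>a z = psi \<mu> (t * z + m\<^sub>o)\<close> and the generating function is the density of the
  family in the mean parametrization; comparing Taylor coefficients gives \<open>Q n = t ^ n * P n\<close>.
  The interchange of sum and integral is purely algebraic, because each coefficient in \<open>z\<close> of
  the exponential is a finite sum of monomials in \<open>x\<close>
  (\<open>integral_power_mult_exponential\<close>, \<open>exponential_form_relations\<close>).

  Conversely, \<open>psi\<close> is analytic by the inverse function theorem, so \<open>a\<close> and \<open>b\<close> extend to
  holomorphic functions on a complex disc. The Taylor series in \<open>z\<close> of \<open>exp (a z * x + b z)\<close>
  converges on that disc for every \<open>x\<close>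
  (\<open>exponential_has_uniform_power_series\<close>).

  The formulas for \<open>a\<close> and \<open>b\<close> have to be carried from a neighbourhood of \<open>0\<close> to the whole interval
  of convergence, and the danger is that \<open>a\<close> leaves the open set \<open>Theta \<mu>\<close>. Without 2-orthogonality
  this can happen: for the family of the stable law of index \<open>3/2\<close>, \<open>k \<theta>\<close> is, up to a translation of \<open>\<theta>\<close>
  and an additive constant, a multiple of \<open>(- \<theta>) powr (3/2)\<close>, and then \<open>a\<close> and \<open>b\<close> are polynomials
  although the means domain is a half line. The case
  \<open>p = Q 2\<close> excludes it, since it says that the variance is a polynomial \<open>V\<close> in the mean.
  Then the \<open>n\<close>-th moment of \<open>P\<^sub>\<theta>\<close> is a polynomial in the mean, obtained by iterating
  \<open>h \<mapsto> m * h + V * h'\<close>, and is at most \<open>n! * C ^ n\<close> with one constant \<open>C\<close> for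
  all \<open>\<theta>\<close> of bounded mean. Hence \<open>Theta \<mu>\<close> contains a ball of fixed radius around each such \<open>\<theta>\<close>
  (\<open>Theta_uniform_margin\<close>). As \<open>k' (a z) = t * z + m\<^sub>o\<close> stays bounded, \<open>a\<close> cannot reach
  the boundary, and a connectedness argument finishes the proof (\<open>relations_extend\<close>).
\<close>

section \<open>Real analytic functions of one variable\<close>

text \<open>
  Dividing by the leading power of the variable leaves a function that is continuous and nonzero
  at the centre, so zeros of an analytic function are isolated.
\<close>

lemma fps_expansion_nonzero_imp_eventually_nonzero:
  fixes f :: "real \<Rightarrow> real"
  assumes "f has_fps_expansion F" "F \<noteq> 0"
  shows "eventually (\<lambda>h. f h \<noteq> 0) (at 0)"
proof -
  define n where "n = subdegree F"
  define g where "g = (\<lambda>x. if x = 0 then fps_nth F n else f x / x ^ n)"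
  have "g has_fps_expansion fps_shift n F"
    unfolding g_def by (rule has_fps_expansion_shift[OF assms(1)]) (auto simp: n_def)
  then have "isCont g 0"
    by (rule has_fps_expansion_imp_continuous)
  moreover have "g 0 \<noteq> 0"
    using assms(2) by (simp add: g_def n_def)
  ultimately have "eventually (\<lambda>h. g h \<noteq> 0) (at 0)"
    unfolding isCont_def by (rule tendsto_imp_eventually_ne)
  moreover have "eventually (\<lambda>h::real. h \<noteq> 0) (at 0)"
    by (simp add: eventually_at_filter)
  ultimately show ?thesis
    by eventually_elim (auto simp: g_def)
qed

lemma fps_expansion_unique_real:
  fixes f :: "real \<Rightarrow> real"
  assumes "f has_fps_expansion F" "f has_fps_expansion G"
  shows "F = G"
proof (rule ccontr)
  assume "F \<noteq> G"
  moreover have "(\<lambda>h. f h - f h) has_fps_expansion F - G"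
    by (rule has_fps_expansion_diff[OF assms])
  ultimately have "eventually (\<lambda>h::real. False) (at 0)"
    using fps_expansion_nonzero_imp_eventually_nonzero by fastforce
  then show False
    using at_neq_bot eventually_False by blast
qed

text \<open>
  Composition and inversion of convergent power series are available over the complex numbers.
  The lemmas below move a real expansion to the complex plane and back.
\<close>

abbreviation fps_complex :: "real fps \<Rightarrow> complex fps" where
  "fps_complex A \<equiv> Abs_fps (\<lambda>n. complex_of_real (fps_nth A n))"

lemma fps_complex_mult: "fps_complex (A * B) = fps_complex A * fps_complex B"
  by (simp add: fps_eq_iff fps_mult_nth)

lemma fps_complex_power: "fps_complex (A ^ n) = fps_complex A ^ n"
proof (induction n)
  case 0
  show ?case
    by (simp add: fps_eq_iff)
qed (simp add: fps_complex_mult)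

lemma fps_complex_compose: "fps_complex (A oo B) = fps_complex A oo fps_complex B"
  by (simp add: fps_eq_iff fps_compose_nth flip: fps_complex_power)

lemma has_fps_expansion_complexify:
  assumes "f has_fps_expansion A"
  obtains F where "F has_fps_expansion fps_complex A"
    "eventually (\<lambda>h. F (complex_of_real h) = complex_of_real (f h)) (nhds 0)"
proof
  have "conv_radius (fps_nth (fps_complex A)) = conv_radius (fps_nth A)"
    by (subst (1 2) conv_radius_norm[symmetric]) simp
  then have radius: "fps_conv_radius (fps_complex A) = fps_conv_radius A"
    by (simp add: fps_conv_radius_def)
  also have "\<dots> > 0"
    using assms by (simp add: has_fps_expansion_def)
  finally show "eval_fps (fps_complex A) has_fps_expansion fps_complex A"
    by (rule eval_fps_has_fps_expansion)
  have "eventually (\<lambda>h. h \<in> eball 0 (fps_conv_radius A)) (nhds 0)"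
    using assms by (intro eventually_nhds_in_open) (auto simp: has_fps_expansion_def zero_ereal_def)
  moreover have "eventually (\<lambda>h. eval_fps A h = f h) (nhds 0)"
    using assms by (simp add: has_fps_expansion_def)
  ultimately show "eventually (\<lambda>h. eval_fps (fps_complex A) (complex_of_real h)
      = complex_of_real (f h)) (nhds 0)"
  proof eventually_elim
    case (elim h)
    then have "(\<lambda>n. fps_nth A n * h ^ n) sums f h"
      using sums_eval_fps[of h A] by simp
    then have "(\<lambda>n. complex_of_real (fps_nth A n * h ^ n)) sums complex_of_real (f h)"
      by (rule sums_of_real)
    then show ?case
      by (simp add: eval_fps_def sums_iff)
  qed
qed

lemma has_fps_expansion_real_restriction:
  assumes "F has_fps_expansion C"
    and "eventually (\<lambda>h. F (complex_of_real h) = complex_of_real (f h)) (nhds 0)"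
  shows "f has_fps_expansion Abs_fps (\<lambda>n. Re (fps_nth C n))"
proof (rule has_fps_expansionI)
  have "((\<lambda>h. complex_of_real h) \<longlongrightarrow> complex_of_real 0) (nhds 0)"
    by (intro tendsto_intros filterlim_ident)
  then have lim: "filterlim complex_of_real (nhds 0) (nhds 0)"
    by simp
  have "eventually (\<lambda>h. h \<in> eball 0 (fps_conv_radius C)) (nhds 0)"
    using assms by (intro eventually_nhds_in_open) (auto simp: has_fps_expansion_def zero_ereal_def)
  from eventually_compose_filterlim[OF this lim]
  have 1: "eventually (\<lambda>h. complex_of_real h \<in> eball 0 (fps_conv_radius C)) (nhds 0)" .
  have "eventually (\<lambda>h. eval_fps C h = F h) (nhds 0)"
    using assms(1) by (simp add: has_fps_expansion_def)
  from eventually_compose_filterlim[OF this lim]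
  have 2: "eventually (\<lambda>h. eval_fps C (complex_of_real h) = F (complex_of_real h)) (nhds 0)" .
  from 1 2 assms(2)
  show "eventually (\<lambda>h. (\<lambda>n. fps_nth (Abs_fps (\<lambda>n. Re (fps_nth C n))) n * h ^ n) sums f h) (nhds 0)"
  proof eventually_elim
    case (elim h)
    then have "(\<lambda>n. fps_nth C n * complex_of_real h ^ n) sums complex_of_real (f h)"
      using sums_eval_fps[of "complex_of_real h" C] by simp
    then have "(\<lambda>n. Re (fps_nth C n * complex_of_real h ^ n)) sums f h"
      using sums_Re by force
    then show ?case
      by (simp flip: of_real_power)
  qed
qed

text \<open>
  The formal composition of the two real series is the real form of the formal composition of
  their complexifications, which converges to the composed holomorphic functions.
\<close>

lemma has_fps_expansion_compose_real:
  fixes f g :: "real \<Rightarrow> real"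
  assumes "f has_fps_expansion A" "g has_fps_expansion B" "fps_nth B 0 = 0"
  shows "(\<lambda>h. f (g h)) has_fps_expansion (A oo B)"
proof -
  obtain F where F: "F has_fps_expansion fps_complex A"
    "eventually (\<lambda>h. F (complex_of_real h) = complex_of_real (f h)) (nhds 0)"
    using has_fps_expansion_complexify[OF assms(1)] .
  obtain G where G: "G has_fps_expansion fps_complex B"
    "eventually (\<lambda>h. G (complex_of_real h) = complex_of_real (g h)) (nhds 0)"
    using has_fps_expansion_complexify[OF assms(2)] .
  have "g 0 = 0"
    using assms(2,3) by (auto simp: has_fps_expansion_def eval_fps_at_0 dest: eventually_nhds_x_imp_x)
  moreover have "isCont g 0"
    by (rule has_fps_expansion_imp_continuous[OF assms(2)])
  ultimately have "filterlim g (nhds 0) (nhds 0)"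
    using tendsto_at_iff_tendsto_nhds[of g 0] by (simp add: isCont_def)
  from eventually_compose_filterlim[OF F(2) this] G(2)
  have "eventually (\<lambda>h. (F \<circ> G) (complex_of_real h) = complex_of_real (f (g h))) (nhds 0)"
    by eventually_elim simp
  moreover have "(F \<circ> G) has_fps_expansion (fps_complex A oo fps_complex B)"
    using assms(3) by (intro has_fps_expansion_compose F G) simp
  ultimately have "(\<lambda>h. f (g h)) has_fps_expansion
      Abs_fps (\<lambda>n. Re (fps_nth (fps_complex A oo fps_complex B) n))"
    by (intro has_fps_expansion_real_restriction)
  then show ?thesis
    by (simp add: fps_nth_inverse flip: fps_complex_compose)
qed

lemma real_analytic_on_singleton_imp:
  "(\<And>x. x \<in> S \<Longrightarrow> real_analytic_on f {x}) \<Longrightarrow> real_analytic_on f S"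
  by (simp add: real_analytic_on_def)

lemma real_analytic_on_subset:
  "real_analytic_on f S \<Longrightarrow> T \<subseteq> S \<Longrightarrow> real_analytic_on f T"
  by (auto simp: real_analytic_on_def)

lemma real_analytic_on_const: "real_analytic_on (\<lambda>x. c) S"
  unfolding real_analytic_on_def using has_fps_expansion_const by blast

lemma real_analytic_on_ident: "real_analytic_on (\<lambda>x. x) S"
  unfolding real_analytic_on_def
  using has_fps_expansion_add[OF has_fps_expansion_const has_fps_expansion_fps_X] by blast

lemma real_analytic_on_add:
  "real_analytic_on f S \<Longrightarrow> real_analytic_on g S \<Longrightarrow> real_analytic_on (\<lambda>x. f x + g x) S"
  unfolding real_analytic_on_def using has_fps_expansion_add by blast

lemma real_analytic_on_diff:
  "real_analytic_on f S \<Longrightarrow> real_analytic_on g S \<Longrightarrow> real_analytic_on (\<lambda>x. f x - g x) S"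
  unfolding real_analytic_on_def using has_fps_expansion_diff by blast

lemma real_analytic_on_mult:
  "real_analytic_on f S \<Longrightarrow> real_analytic_on g S \<Longrightarrow> real_analytic_on (\<lambda>x. f x * g x) S"
  unfolding real_analytic_on_def using has_fps_expansion_mult by blast

lemma has_fps_expansion_nth_0: 
  assumes "f has_fps_expansion F"
  shows "fps_nth F 0 = f 0"
  using assms by (auto simp: has_fps_expansion_def eval_fps_at_0 dest: eventually_nhds_x_imp_x)

lemma real_analytic_on_divide:
  assumes "real_analytic_on f S" "real_analytic_on g S" "\<And>x. x \<in> S \<Longrightarrow> g x \<noteq> 0"
  shows "real_analytic_on (\<lambda>x. f x / g x) S"
proof -
  have "real_analytic_on (\<lambda>x. inverse (g x)) S"
    unfolding real_analytic_on_def
  proof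
    fix x assume x: "x \<in> S"
    with assms(2) obtain B where B: "(\<lambda>h. g (x + h)) has_fps_expansion B"
      unfolding real_analytic_on_def by blast
    have "fps_nth B 0 \<noteq> 0"
      using has_fps_expansion_nth_0[OF B] assms(3)[OF x] by simp
    from has_fps_expansion_inverse[OF B this]
    show "\<exists>C. (\<lambda>h. inverse (g (x + h))) has_fps_expansion C" ..
  qed
  from real_analytic_on_mult[OF assms(1) this] show ?thesis
    by (simp add: divide_inverse)
qed

lemma real_analytic_on_poly:
  assumes "real_analytic_on f S"
  shows "real_analytic_on (\<lambda>x. poly p (f x)) S"
proof (induction p)
  case (pCons c p)
  then show ?case
    using assms by (simp add: real_analytic_on_add real_analytic_on_mult real_analytic_on_const)
qed (simp add: real_analytic_on_const)

lemma real_analytic_on_compose: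
  assumes "real_analytic_on f (g ` S)" "real_analytic_on g S"
  shows "real_analytic_on (\<lambda>x. f (g x)) S"
  unfolding real_analytic_on_def
proof
  fix x assume "x \<in> S"
  with assms(1) obtain A where A: "(\<lambda>h. f (g x + h)) has_fps_expansion A"
    unfolding real_analytic_on_def by blast
  from \<open>x \<in> S\<close> assms(2) obtain B where B: "(\<lambda>h. g (x + h)) has_fps_expansion B"
    unfolding real_analytic_on_def by blast
  have "(\<lambda>h. g (x + h) - g x) has_fps_expansion B - fps_const (g x)"
    by (intro has_fps_expansion_diff B has_fps_expansion_const)
  from has_fps_expansion_compose_real[OF A this]
  show "\<exists>C. (\<lambda>h. f (g (x + h))) has_fps_expansion C"
    using has_fps_expansion_nth_0[OF B] by auto
qed

lemma eventually_nhds_shift: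
  "eventually P (nhds (x::real)) \<longleftrightarrow> eventually (\<lambda>h. P (x + h)) (nhds 0)"
  by (simp add: nhds_to_0[of x] eventually_filtermap add.commute)

lemma eventually_at_shift:
  "eventually P (at (x::real)) \<longleftrightarrow> eventually (\<lambda>h. P (x + h)) (at 0)"
  by (simp add: at_to_0[of x] eventually_filtermap add.commute)

lemma real_analytic_on_transfer:
  assumes "real_analytic_on f {x}" "eventually (\<lambda>y. f y = g y) (nhds x)"
  shows "real_analytic_on g {x}"
proof -
  from assms(1) obtain A where "(\<lambda>h. f (x + h)) has_fps_expansion A"
    by (auto simp: real_analytic_on_def)
  then have "(\<lambda>h. g (x + h)) has_fps_expansion A"
    using assms(2) has_fps_expansion_cong[of "\<lambda>h. f (x + h)" "\<lambda>h. g (x + h)"]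
    by (simp add: eventually_nhds_shift[of _ x])
  then show ?thesis
    by (auto simp: real_analytic_on_def)
qed

lemma real_analytic_on_imp_isCont:
  assumes "real_analytic_on f S" "x \<in> S"
  shows "isCont f x"
proof -
  obtain A where "(\<lambda>h. f (x + h)) has_fps_expansion A"
    using assms by (auto simp: real_analytic_on_def)
  then have "isCont (\<lambda>h. f (x + h)) 0"
    by (rule has_fps_expansion_imp_continuous)
  then show ?thesis
    by (simp add: isCont_def LIM_offset_zero_iff)
qed

text \<open>
  The local identity theorem: near a limit point of its zeros an analytic function vanishes.
\<close>

lemma real_analytic_frequently_zero:
  assumes "real_analytic_on f {x}" "frequently (\<lambda>y. f y = 0) (at x)"
  shows "eventually (\<lambda>y. f y = 0) (nhds x)"
proof -
  obtain A where A: "(\<lambda>h. f (x + h)) has_fps_expansion A"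
    using assms(1) by (auto simp: real_analytic_on_def)
  show ?thesis
  proof (cases "A = 0")
    case True
    then show ?thesis
      using A by (simp add: has_fps_expansion_0_iff eventually_nhds_shift[of _ x])
  next
    case False
    with fps_expansion_nonzero_imp_eventually_nonzero[OF A] assms(2) show ?thesis
      by (simp add: frequently_def eventually_at_shift[of _ x])
  qed
qed

text \<open>
  The set of points near which the function vanishes is open by definition and closed by the
  local identity theorem, hence everything.
\<close>

lemma real_analytic_identity:
  assumes f: "real_analytic_on f S" and S: "open S" "connected S"
    and x: "x \<in> S" "eventually (\<lambda>y. f y = 0) (nhds x)" and y: "y \<in> S"
  shows "f y = 0"
proof -
  define Z where "Z = {z \<in> S. eventually (\<lambda>y. f y = 0) (nhds z)}"
  have "open Z"
    unfolding open_subopen[of Z]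
  proof
    fix z assume "z \<in> Z"
    then have "eventually (\<lambda>w. w \<in> Z) (nhds z)"
      unfolding Z_def using S(1) by (auto intro!: eventually_conj eventually_nhds_in_open simp: eventually_eventually)
    then show "\<exists>T. open T \<and> z \<in> T \<and> T \<subseteq> Z"
      by (auto simp: eventually_nhds)
  qed
  then have "openin (top_of_set S) Z"
    using S(1) by (auto simp: openin_open_eq Z_def)
  moreover have "closedin (top_of_set S) Z"
    unfolding closedin_limpt
  proof safe
    fix z assume z: "z islimpt Z" "z \<in> S"
    have "frequently (\<lambda>y. f y = 0) (at z)"
      using z(1) unfolding islimpt_conv_frequently_at
      by (rule frequently_elim1) (auto simp: Z_def dest: eventually_nhds_x_imp_x)
    then show "z \<in> Z"
      using real_analytic_frequently_zero[of f z] f z(2)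
      by (auto simp: Z_def real_analytic_on_def)
  qed (simp add: Z_def)
  moreover have "x \<in> Z"
    using x by (simp add: Z_def)
  ultimately have "Z = S"
    using S(2) by (auto simp: connected_clopen)
  with y show ?thesis
    by (auto simp: Z_def dest: eventually_nhds_x_imp_x)
qed

text \<open>
  This criterion reduces analyticity of the logarithm and of inverse functions to the holomorphic
  case, where it comes for free.
\<close>

lemma real_analytic_on_iff_complex:
  "real_analytic_on f {x} \<longleftrightarrow>
    (\<exists>F. F analytic_on {complex_of_real x} \<and>
      eventually (\<lambda>y. F (complex_of_real y) = complex_of_real (f y)) (nhds x))"
proof
  assume "real_analytic_on f {x}"
  then obtain A where A: "(\<lambda>h. f (x + h)) has_fps_expansion A"
    by (auto simp: real_analytic_on_def)
  from has_fps_expansion_complexify[OF A]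
  obtain F where F: "F has_fps_expansion fps_complex A"
    "eventually (\<lambda>h. F (complex_of_real h) = complex_of_real (f (x + h))) (nhds 0)"
    by blast
  have "(\<lambda>z. F (z - complex_of_real x)) analytic_on {complex_of_real x}"
    using F(1) by (intro has_fps_expansion_imp_analytic[where F = "fps_complex A"]) simp
  with F(2) show "\<exists>F. F analytic_on {complex_of_real x} \<and>
      eventually (\<lambda>y. F (complex_of_real y) = complex_of_real (f y)) (nhds x)"
    by (intro exI[of _ "\<lambda>z. F (z - complex_of_real x)"]) (simp add: eventually_nhds_shift[of _ x])
next
  assume "\<exists>F. F analytic_on {complex_of_real x} \<and>
      eventually (\<lambda>y. F (complex_of_real y) = complex_of_real (f y)) (nhds x)"
  then obtain F where F: "F analytic_on {complex_of_real x}"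
    "eventually (\<lambda>y. F (complex_of_real y) = complex_of_real (f y)) (nhds x)"
    by blast
  from has_fps_expansion_real_restriction[OF analytic_at_imp_has_fps_expansion[OF F(1)], of "\<lambda>h. f (x + h)"]
  show "real_analytic_on f {x}"
    using F(2) by (auto simp: real_analytic_on_def eventually_nhds_shift[of _ x])
qed

lemma real_analytic_on_exp: "real_analytic_on exp S"
proof (rule real_analytic_on_singleton_imp)
  fix x :: real
  show "real_analytic_on exp {x}"
    unfolding real_analytic_on_iff_complex
    by (intro exI[of _ exp]) (auto intro!: analytic_intros simp: exp_of_real)
qed

lemma real_analytic_on_ln:
  assumes "S \<subseteq> {0<..}"
  shows "real_analytic_on ln S"
proof (rule real_analytic_on_singleton_imp)
  fix x assume "x \<in> S"
  with assms have x: "x > 0" by auto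
  have "eventually (\<lambda>y. y \<in> {0<..}) (nhds x)"
    using x by (intro eventually_nhds_in_open) auto
  then have "eventually (\<lambda>y. Ln (complex_of_real y) = complex_of_real (ln y)) (nhds x)"
    by eventually_elim (simp add: Ln_of_real)
  moreover have "Ln analytic_on {complex_of_real x}"
    using x by (intro analytic_on_ln analytic_on_ident) (auto simp: complex_nonpos_Reals_iff)
  ultimately show "real_analytic_on ln {x}"
    unfolding real_analytic_on_iff_complex by blast
qed

lemma fps_expansion_imp_has_derivative:
  fixes f :: "real \<Rightarrow> real"
  assumes "(\<lambda>h. f (x + h)) has_fps_expansion A"
  shows "(f has_real_derivative fps_nth A 1) (at x)"
proof -
  have "(eval_fps A has_field_derivative eval_fps (fps_deriv A) 0) (at 0)"
    using assms by (intro has_field_derivative_eval_fps) (simp add: has_fps_expansion_def zero_ereal_def)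
  moreover have "eventually (\<lambda>h. eval_fps A h = f (x + h)) (nhds 0)"
    using assms by (simp add: has_fps_expansion_def)
  ultimately have "((\<lambda>h. f (x + h)) has_field_derivative fps_nth A 1) (at 0)"
    using DERIV_cong_ev[of 0 0 "eval_fps A" "\<lambda>h. f (x + h)"] by (simp add: eval_fps_at_0)
  then show ?thesis
    using DERIV_shift[of f "fps_nth A 1" 0 x] by (simp add: add.commute)
qed

text \<open>
  The holomorphic extension of \<open>f\<close> has nonzero derivative at the point, so it is locally
  injective and its inverse is holomorphic. That inverse extends \<open>g\<close>, because \<open>g\<close> is continuous
  and therefore stays in the disc of injectivity.
\<close>

lemma real_analytic_local_inverse:
  fixes f g :: "real \<Rightarrow> real"
  assumes f: "real_analytic_on f {x}" and deriv: "(f has_real_derivative D) (at x)" "D \<noteq> 0"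
    and inv: "eventually (\<lambda>y. f (g y) = y) (nhds (f x))"
    and g: "isCont g (f x)" "g (f x) = x"
  shows "real_analytic_on g {f x}"
proof -
  obtain A where A: "(\<lambda>h. f (x + h)) has_fps_expansion A"
    using f unfolding real_analytic_on_def by blast
  have "fps_nth A 1 = D"
    using DERIV_unique[OF fps_expansion_imp_has_derivative[OF A] deriv(1)] .
  obtain F where F: "F has_fps_expansion fps_complex A"
    "eventually (\<lambda>h. F (complex_of_real h) = complex_of_real (f (x + h))) (nhds 0)"
    using has_fps_expansion_complexify[OF A] .
  obtain U where U: "open U" "0 \<in> U" "F holomorphic_on U"
    using has_fps_expansion_imp_analytic_0[OF F(1)] unfolding analytic_at by blast
  have "deriv F 0 \<noteq> 0"
    using fps_nth_fps_expansion[OF F(1), of 1] deriv(2) \<open>fps_nth A 1 = D\<close> by auto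
  then obtain r where r: "r > 0" "ball 0 r \<subseteq> U"
      "open (F ` ball 0 r)" "inj_on F (ball 0 r)"
    using has_complex_derivative_locally_invertible[OF U(3) U(2) U(1)] by metis
  let ?B = "ball (0::complex) r"
  have "F holomorphic_on ?B"
    using U(3) r(2) by (rule holomorphic_on_subset)
  then obtain G where G: "G holomorphic_on F ` ?B" "\<And>z. z \<in> ?B \<Longrightarrow> G (F z) = z"
    using holomorphic_has_inverse[OF _ open_ball r(4)] by metis
  have "F 0 = complex_of_real (f x)"
    using eventually_nhds_x_imp_x[OF F(2)] by simp
  then have "complex_of_real (f x) \<in> F ` ?B"
    using r(1) by (metis centre_in_ball image_eqI)
  then have "G analytic_on {complex_of_real (f x)}"
    using G(1) r(3) analytic_at by blast
  then have "(\<lambda>z. complex_of_real x + G z) analytic_on {complex_of_real (f x)}"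
    by (intro analytic_intros)
  moreover have "eventually (\<lambda>y. complex_of_real x + G (complex_of_real y) = complex_of_real (g y)) (nhds (f x))"
  proof -
    have "(g \<longlongrightarrow> x) (nhds (f x))"
      using g tendsto_at_iff_tendsto_nhds[of g "f x"] by (simp add: isCont_def)
    then have "((\<lambda>y. g y - x) \<longlongrightarrow> x - x) (nhds (f x))"
      by (intro tendsto_intros)
    then have lim: "filterlim (\<lambda>y. g y - x) (nhds 0) (nhds (f x))"
      by simp
    have "eventually (\<lambda>h. h \<in> ball 0 r) (nhds 0)"
      using r(1) by (intro eventually_nhds_in_open) auto
    from eventually_compose_filterlim[OF this lim] eventually_compose_filterlim[OF F(2) lim] inv
    show ?thesis
    proof eventually_elim
      case (elim y)
      then have "complex_of_real (g y - x) \<in> ?B"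
        by (simp del: of_real_diff)
      from G(2)[OF this] elim show ?case by simp
    qed
  qed
  ultimately show ?thesis
    unfolding real_analytic_on_iff_complex by (intro exI[of _ "\<lambda>z. complex_of_real x + G z"]) blast
qed

lemma higher_deriv_eq_fps_nth:
  fixes f :: "real \<Rightarrow> real"
  assumes "(\<lambda>h. f (x + h)) has_fps_expansion A"
  shows "(deriv ^^ n) f x = fact n * fps_nth A n"
  using assms
proof (induction n arbitrary: f A)
  case 0
  then show ?case
    using has_fps_expansion_nth_0[of "\<lambda>h. f (x + h)" A] by simp
next
  case (Suc n)
  have "deriv (\<lambda>h. f (x + h)) = (\<lambda>h. deriv f (x + h))"
    by (simp add: deriv_def DERIV_shift[of f] add.commute fun_eq_iff)
  then have "(\<lambda>h. deriv f (x + h)) has_fps_expansion fps_deriv A"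
    using has_fps_expansion_deriv[OF Suc.prems] by simp
  from Suc.IH[OF this] show ?case
    by (simp add: funpow_swap1 algebra_simps)
qed

text \<open>
  The radius of convergence must not depend on \<open>x\<close>. For this reason \<open>a\<close> and \<open>b\<close> are extended to
  holomorphic functions on one disc: the exponential is then holomorphic on the same disc for each
  \<open>x\<close>, and its Taylor series converges there.
\<close>

lemma exponential_has_uniform_power_series:
  assumes "real_analytic_on a {0}" "real_analytic_on b {0}"
  obtains \<rho> where "\<rho> > 0" "real_analytic_on a {-\<rho><..<\<rho>}" "real_analytic_on b {-\<rho><..<\<rho>}"
    "\<And>x. \<exists>c. \<forall>z\<in>{-\<rho><..<\<rho>}. (\<lambda>n. c n * z ^ n) sums exp (a z * x + b z)"
proof -
  obtain Fa where Fa: "Fa analytic_on {0}"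
    "eventually (\<lambda>y. Fa (complex_of_real y) = complex_of_real (a y)) (nhds 0)"
    using assms(1) unfolding real_analytic_on_iff_complex by auto
  obtain Fb where Fb: "Fb analytic_on {0}"
    "eventually (\<lambda>y. Fb (complex_of_real y) = complex_of_real (b y)) (nhds 0)"
    using assms(2) unfolding real_analytic_on_iff_complex by auto
  obtain Ua where Ua: "open Ua" "0 \<in> Ua" "Fa holomorphic_on Ua"
    using Fa(1) unfolding analytic_at by blast
  obtain Ub where Ub: "open Ub" "0 \<in> Ub" "Fb holomorphic_on Ub"
    using Fb(1) unfolding analytic_at by blast
  obtain r1 where r1: "r1 > 0" "ball 0 r1 \<subseteq> Ua \<inter> Ub"
    using open_contains_ball[of "Ua \<inter> Ub"] Ua Ub by (meson IntI open_Int)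
  obtain r2 where r2: "r2 > 0"
    "\<And>y. dist y 0 < r2 \<Longrightarrow> Fa (complex_of_real y) = complex_of_real (a y) \<and> Fb (complex_of_real y) = complex_of_real (b y)"
    using eventually_conj[OF Fa(2) Fb(2)] unfolding eventually_nhds_metric by blast
  define \<rho> where "\<rho> = min r1 r2"
  have \<rho>: "\<rho> > 0"
    using r1 r2 by (simp add: \<rho>_def)
  have real: "Fa (complex_of_real y) = complex_of_real (a y)" "Fb (complex_of_real y) = complex_of_real (b y)"
    if "y \<in> {-\<rho><..<\<rho>}" for y
    using r2(2)[of y] that by (auto simp: \<rho>_def)
  have hol: "Fa holomorphic_on ball 0 \<rho>" "Fb holomorphic_on ball 0 \<rho>"
    using Ua(3) Ub(3) r1(2) by (auto simp: \<rho>_def elim!: holomorphic_on_subset)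
  have analytic: "real_analytic_on f {-\<rho><..<\<rho>}"
    if F: "F holomorphic_on ball 0 \<rho>" "\<And>y. y \<in> {-\<rho><..<\<rho>} \<Longrightarrow> F (complex_of_real y) = complex_of_real (f y)"
    for F f
  proof (rule real_analytic_on_singleton_imp)
    fix y assume y: "y \<in> {-\<rho><..<\<rho>}"
    have "F analytic_on {complex_of_real y}"
      using F(1) y unfolding analytic_at by (intro exI[of _ "ball 0 \<rho>"]) auto
    moreover have "eventually (\<lambda>w. w \<in> {-\<rho><..<\<rho>}) (nhds y)"
      using y by (intro eventually_nhds_in_open) auto
    then have "eventually (\<lambda>w. F (complex_of_real w) = complex_of_real (f w)) (nhds y)"
      by (rule eventually_mono) (rule F(2))
    ultimately show "real_analytic_on f {y}"
      unfolding real_analytic_on_iff_complex by blast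
  qed
  show ?thesis
  proof (rule that[OF \<rho>])
    show "real_analytic_on a {-\<rho><..<\<rho>}" "real_analytic_on b {-\<rho><..<\<rho>}"
      using analytic[OF hol(1)] analytic[OF hol(2)] real by auto
    fix x
    define H where "H z = exp (Fa z * complex_of_real x + Fb z)" for z
    have H: "H holomorphic_on ball 0 \<rho>"
      unfolding H_def by (intro holomorphic_intros hol)
    have "H analytic_on {0}"
      using H \<rho> unfolding analytic_at by (intro exI[of _ "ball 0 \<rho>"]) auto
    then have H': "H has_fps_expansion fps_expansion H 0"
      by (rule analytic_at_imp_has_fps_expansion_0)
    have "(\<lambda>n. Re (fps_nth (fps_expansion H 0) n) * z ^ n) sums exp (a z * x + b z)"
      if z: "z \<in> {-\<rho><..<\<rho>}" for z
    proof -
      have "(\<lambda>n. fps_nth (fps_expansion H 0) n * complex_of_real z ^ n) sums H (complex_of_real z)"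
        using z H by (intro has_fps_expansion_imp_sums_complex[OF H', of "ereal \<rho>"]) auto
      then have "(\<lambda>n. Re (fps_nth (fps_expansion H 0) n * complex_of_real z ^ n)) sums Re (H (complex_of_real z))"
        by (rule sums_Re)
      moreover have "H (complex_of_real z) = complex_of_real (exp (a z * x + b z))"
        by (simp add: H_def real[OF z] flip: exp_of_real)
      ultimately show ?thesis
        by (simp flip: of_real_power)
    qed
    then show "\<exists>c. \<forall>z\<in>{-\<rho><..<\<rho>}. (\<lambda>n. c n * z ^ n) sums exp (a z * x + b z)"
      by (intro exI[of _ "\<lambda>n. Re (fps_nth (fps_expansion H 0) n)"] ballI)
  qed
qed

lemma higher_deriv_eq_scaled_coefficient:
  fixes f :: "real \<Rightarrow> real"
  assumes t: "t \<noteq> 0" and series: "eventually (\<lambda>z. (\<lambda>n. c n * z ^ n) sums f (t * z + m)) (nhds 0)"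
  shows "t ^ n * (deriv ^^ n) f m = fact n * c n"
proof -
  have "((\<lambda>w. w / t) \<longlongrightarrow> 0 / t) (nhds 0)"
    by (intro tendsto_intros filterlim_ident) (rule t)
  then have "filterlim (\<lambda>w. w / t) (nhds 0) (nhds 0)"
    by simp
  from eventually_compose_filterlim[OF series this]
  have "eventually (\<lambda>w. (\<lambda>n. c n / t ^ n * w ^ n) sums f (m + w)) (nhds 0)"
    by eventually_elim (use t in \<open>simp add: power_divide add.commute\<close>)
  then have "(\<lambda>w. f (m + w)) has_fps_expansion Abs_fps (\<lambda>n. c n / t ^ n)"
    by (intro has_fps_expansionI) simp
  from higher_deriv_eq_fps_nth[OF this, of n] show ?thesis
    using t by simp
qed

section \<open>Moments of the exponentially tilted measures\<close>

lemma Theta_subset: "Theta \<mu> \<subseteq> {\<theta>. laplace \<mu> \<theta> < \<infinity>}"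
  unfolding Theta_def by (rule interior_subset)

lemma open_Theta: "open (Theta \<mu>)"
  by (simp add: Theta_def)

lemma convex_Theta:
  assumes [measurable_cong]: "sets \<mu> = sets borel"
  shows "convex (Theta \<mu>)"
  unfolding Theta_def
proof (rule convex_interior, rule is_interval_convex)
  show "is_interval {\<theta>. laplace \<mu> \<theta> < \<infinity>}"
    unfolding is_interval_1
  proof safe
    fix a b x assume fin: "laplace \<mu> a < \<infinity>" "laplace \<mu> b < \<infinity>" and x: "a \<le> x" "x \<le> b"
    have "laplace \<mu> x \<le> (\<integral>\<^sup>+ y. ennreal (exp (a * y)) + ennreal (exp (b * y)) \<partial>\<mu>)"
      unfolding laplace_def
    proof (rule nn_integral_mono)
      fix y :: real
      have "x * y \<le> a * y \<or> x * y \<le> b * y"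
        using x by (cases "y \<ge> 0") (auto intro: mult_right_mono mult_right_mono_neg)
      then have "exp (x * y) \<le> exp (a * y) + exp (b * y)"
        by (smt (verit) exp_gt_zero exp_le_cancel_iff)
      then show "ennreal (exp (x * y)) \<le> ennreal (exp (a * y)) + ennreal (exp (b * y))"
        by (simp flip: ennreal_plus)
    qed
    also have "\<dots> = laplace \<mu> a + laplace \<mu> b"
      unfolding laplace_def by (rule nn_integral_add) measurable
    also have "\<dots> < \<infinity>"
      using fin by simp
    finally show "laplace \<mu> x < \<infinity>" .
  qed
qed

lemma exp_real_sums: "(\<lambda>n. y ^ n / fact n) sums exp (y::real)"
  using exp_converges[of y] by (simp add: divide_inverse mult.commute)

lemma power_le_exp:
  fixes y \<delta> :: real
  assumes "y \<ge> 0" "\<delta> > 0"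
  shows "y ^ j \<le> fact j / \<delta> ^ j * exp (\<delta> * y)"
proof -
  have "(\<delta> * y) ^ j / fact j \<le> exp (\<delta> * y)"
    using sum_le_suminf[of "\<lambda>n. (\<delta> * y) ^ n / fact n" "{j}"] assms exp_real_sums[of "\<delta> * y"]
    by (simp add: sums_iff)
  then show ?thesis
    using assms by (simp add: power_mult_distrib field_simps)
qed

text \<open>
  The properties of a member \<open>\<mu>\<close> of a natural exponential family on which the argument relies. The
  member corresponds to the parameter \<open>0\<close>, whence \<open>0 \<in> Theta \<mu>\<close> and the total mass \<open>1\<close>.
\<close>

locale nef_generator =
  fixes \<mu> :: "real measure"
  assumes sets_mu [measurable_cong]: "sets \<mu> = sets borel"
    and zero_in_Theta: "0 \<in> Theta \<mu>"
    and mass_one: "emeasure \<mu> (space \<mu>) = 1"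
    and not_degenerate: "\<not> (\<exists>c. AE x in \<mu>. x = c)"
begin

text \<open>
  These are the unnormalized moments of the member with parameter \<open>\<theta>\<close>; they are also the
  derivatives of the Laplace transform.
\<close>

definition tilted_moment :: "nat \<Rightarrow> real \<Rightarrow> real" where
  "tilted_moment j \<theta> = (LINT x|\<mu>. x ^ j * exp (\<theta> * x))"

lemma connected_Theta: "connected (Theta \<mu>)"
  using convex_Theta[OF sets_mu] by (rule convex_connected)

lemma Theta_between: "a \<in> Theta \<mu> \<Longrightarrow> b \<in> Theta \<mu> \<Longrightarrow> a \<le> x \<Longrightarrow> x \<le> b \<Longrightarrow> x \<in> Theta \<mu>"
  using connected_Theta by (meson connected_iff_interval)

lemma integrable_exp: "laplace \<mu> \<theta> < \<infinity> \<Longrightarrow> integrable \<mu> (\<lambda>x. exp (\<theta> * x))"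
  by (rule integrableI_nonneg) (auto simp: laplace_def)

lemma integrable_exp_abs:
  assumes "\<theta> - h \<in> Theta \<mu>" "\<theta> + h \<in> Theta \<mu>" "h \<ge> 0"
  shows "integrable \<mu> (\<lambda>x. exp (h * \<bar>x\<bar>) * exp (\<theta> * x))"
proof (rule Bochner_Integration.integrable_bound)
  show "integrable \<mu> (\<lambda>x. exp ((\<theta> - h) * x) + exp ((\<theta> + h) * x))"
    using assms Theta_subset by (intro Bochner_Integration.integrable_add integrable_exp) auto
  show "AE x in \<mu>. norm (exp (h * \<bar>x\<bar>) * exp (\<theta> * x)) \<le> norm (exp ((\<theta> - h) * x) + exp ((\<theta> + h) * x))"
  proof (rule AE_I2)
    fix x
    have "exp (h * \<bar>x\<bar>) * exp (\<theta> * x) \<in> {exp ((\<theta> - h) * x), exp ((\<theta> + h) * x)}"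
      by (cases "x \<ge> 0") (simp_all add: algebra_simps flip: exp_add)
    then have "exp (h * \<bar>x\<bar>) * exp (\<theta> * x) \<le> exp ((\<theta> - h) * x) + exp ((\<theta> + h) * x)"
      by (auto simp: less_imp_le)
    then show "norm (exp (h * \<bar>x\<bar>) * exp (\<theta> * x)) \<le> norm (exp ((\<theta> - h) * x) + exp ((\<theta> + h) * x))"
      by (simp add: abs_mult add_nonneg_nonneg)
  qed
qed measurable

lemma Theta_margin:
  assumes "\<theta> \<in> Theta \<mu>"
  obtains \<delta> where "\<delta> > 0" "\<And>h. \<bar>h\<bar> \<le> \<delta> \<Longrightarrow> \<theta> + h \<in> Theta \<mu>"
proof -
  obtain e where "e > 0" "cball \<theta> e \<subseteq> Theta \<mu>"
    using open_Theta assms open_contains_cball by blast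
  with that[of e] show ?thesis
    by (auto simp: dist_real_def subset_iff)
qed

text \<open>
  As \<open>Theta \<mu>\<close> is open, the exponent \<open>h\<close> can be increased slightly, and the extra exponential
  absorbs the power.
\<close>

lemma integrable_power_exp_abs:
  assumes "\<theta> - h \<in> Theta \<mu>" "\<theta> + h \<in> Theta \<mu>" "h \<ge> 0"
  shows "integrable \<mu> (\<lambda>x. \<bar>x\<bar> ^ j * (exp (h * \<bar>x\<bar>) * exp (\<theta> * x)))"
proof -
  obtain \<delta>1 where \<delta>1: "\<delta>1 > 0" "\<And>k. \<bar>k\<bar> \<le> \<delta>1 \<Longrightarrow> (\<theta> - h) + k \<in> Theta \<mu>"
    using Theta_margin[OF assms(1)] by blast
  obtain \<delta>2 where \<delta>2: "\<delta>2 > 0" "\<And>k. \<bar>k\<bar> \<le> \<delta>2 \<Longrightarrow> (\<theta> + h) + k \<in> Theta \<mu>"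
    using Theta_margin[OF assms(2)] by blast
  define \<delta> where "\<delta> = min \<delta>1 \<delta>2"
  have \<delta>: "\<delta> > 0" "\<theta> - (h + \<delta>) \<in> Theta \<mu>" "\<theta> + (h + \<delta>) \<in> Theta \<mu>"
    using \<delta>1(1) \<delta>2(1) \<delta>1(2)[of "- \<delta>"] \<delta>2(2)[of \<delta>] by (auto simp: \<delta>_def algebra_simps)
  show ?thesis
  proof (rule Bochner_Integration.integrable_bound)
    show "integrable \<mu> (\<lambda>x. fact j / \<delta> ^ j * (exp ((h + \<delta>) * \<bar>x\<bar>) * exp (\<theta> * x)))"
      using \<delta> assms(3) by (intro integrable_mult_right integrable_exp_abs) auto
    show "AE x in \<mu>. norm (\<bar>x\<bar> ^ j * (exp (h * \<bar>x\<bar>) * exp (\<theta> * x)))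
        \<le> norm (fact j / \<delta> ^ j * (exp ((h + \<delta>) * \<bar>x\<bar>) * exp (\<theta> * x)))"
    proof (rule AE_I2)
      fix x
      have "\<bar>x\<bar> ^ j * (exp (h * \<bar>x\<bar>) * exp (\<theta> * x))
          \<le> (fact j / \<delta> ^ j * exp (\<delta> * \<bar>x\<bar>)) * (exp (h * \<bar>x\<bar>) * exp (\<theta> * x))"
        using \<delta>(1) by (intro mult_right_mono power_le_exp) auto
      then show "norm (\<bar>x\<bar> ^ j * (exp (h * \<bar>x\<bar>) * exp (\<theta> * x)))
        \<le> norm (fact j / \<delta> ^ j * (exp ((h + \<delta>) * \<bar>x\<bar>) * exp (\<theta> * x)))"
        using \<delta>(1) by (simp add: abs_mult exp_add distrib_left distrib_right mult_ac)
    qed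
  qed measurable
qed

lemma integrable_power_exp:
  assumes "\<theta> \<in> Theta \<mu>"
  shows "integrable \<mu> (\<lambda>x. x ^ j * exp (\<theta> * x))"
  by (rule Bochner_Integration.integrable_bound[OF integrable_power_exp_abs[of \<theta> 0 j]])
    (use assms in \<open>auto simp: abs_mult power_abs\<close>)

text \<open>
  Expand \<open>exp (h * x)\<close> and integrate termwise. The series of absolute values sums to an integrable
  function as long as \<open>\<theta> - \<bar>h\<bar>\<close> and \<open>\<theta> + \<bar>h\<bar>\<close> both lie in \<open>Theta \<mu>\<close>.
\<close>

lemma tilted_moment_fps_expansion:
  assumes "\<theta> \<in> Theta \<mu>"
  shows "(\<lambda>h. tilted_moment j (\<theta> + h)) has_fps_expansion Abs_fps (\<lambda>n. tilted_moment (j + n) \<theta> / fact n)"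
proof -
  obtain \<delta> where \<delta>: "\<delta> > 0" "\<And>h. \<bar>h\<bar> \<le> \<delta> \<Longrightarrow> \<theta> + h \<in> Theta \<mu>"
    using Theta_margin[OF assms] by blast
  have *: "(\<lambda>n. tilted_moment (j + n) \<theta> / fact n * h ^ n) sums tilted_moment j (\<theta> + h)" if h: "\<bar>h\<bar> \<le> \<delta>" for h
  proof -
    define f where "f n x = x ^ j * exp (\<theta> * x) * ((h * x) ^ n / fact n)" for n x
    have f_sums: "(\<lambda>n. f n x) sums (x ^ j * exp ((\<theta> + h) * x))" for x
      unfolding f_def using sums_mult[OF exp_real_sums[of "h * x"], of "x ^ j * exp (\<theta> * x)"]
      by (simp add: exp_add distrib_right mult.assoc)
    have norm_sums: "(\<lambda>n. norm (f n x)) sums (\<bar>x\<bar> ^ j * (exp (\<bar>h\<bar> * \<bar>x\<bar>) * exp (\<theta> * x)))" for x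
      unfolding f_def using sums_mult[OF exp_real_sums[of "\<bar>h\<bar> * \<bar>x\<bar>"], of "\<bar>x\<bar> ^ j * exp (\<theta> * x)"]
      by (simp add: abs_mult power_abs power_mult_distrib mult_ac)
    have f_eq: "f n = (\<lambda>x. (h ^ n / fact n) * (x ^ (j + n) * exp (\<theta> * x)))" for n
      by (auto simp: f_def power_add power_mult_distrib)
    have int: "integrable \<mu> (f n)" for n
      unfolding f_eq using integrable_power_exp[OF assms] by (rule integrable_mult_right)
    have dom: "integrable \<mu> (\<lambda>x. \<bar>x\<bar> ^ j * (exp (\<bar>h\<bar> * \<bar>x\<bar>) * exp (\<theta> * x)))"
      using \<delta>(2)[of "\<bar>h\<bar>"] \<delta>(2)[of "-\<bar>h\<bar>"] h by (intro integrable_power_exp_abs) auto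
    have summable: "summable (\<lambda>n. LINT x|\<mu>. norm (f n x))"
    proof (rule summableI_nonneg_bounded)
      fix N
      have "(\<Sum>n<N. LINT x|\<mu>. norm (f n x)) = (LINT x|\<mu>. (\<Sum>n<N. norm (f n x)))"
        using int by (intro Bochner_Integration.integral_sum[symmetric] integrable_norm)
      also have "\<dots> \<le> (LINT x|\<mu>. \<bar>x\<bar> ^ j * (exp (\<bar>h\<bar> * \<bar>x\<bar>) * exp (\<theta> * x)))"
      proof (intro integral_mono dom Bochner_Integration.integrable_sum integrable_norm int)
        fix x
        show "(\<Sum>n<N. norm (f n x)) \<le> \<bar>x\<bar> ^ j * (exp (\<bar>h\<bar> * \<bar>x\<bar>) * exp (\<theta> * x))"
          using norm_sums[of x] sum_le_suminf[of "\<lambda>n. norm (f n x)" "{..<N}"] by (simp add: sums_iff)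
      qed
      finally show "(\<Sum>n<N. LINT x|\<mu>. norm (f n x)) \<le> (LINT x|\<mu>. \<bar>x\<bar> ^ j * (exp (\<bar>h\<bar> * \<bar>x\<bar>) * exp (\<theta> * x)))" .
    qed auto
    have "(\<lambda>n. LINT x|\<mu>. f n x) sums (LINT x|\<mu>. (\<Sum>n. f n x))"
      using int summable norm_sums by (intro sums_integral) (auto simp: sums_iff)
    also have "(\<lambda>x. \<Sum>n. f n x) = (\<lambda>x. x ^ j * exp ((\<theta> + h) * x))"
      using f_sums by (auto simp: sums_iff)
    finally show ?thesis
      by (simp add: f_eq tilted_moment_def mult.commute)
  qed
  show ?thesis
  proof (rule has_fps_expansionI)
    have "eventually (\<lambda>h. h \<in> ball 0 \<delta>) (nhds 0)"
      using \<delta>(1) by (intro eventually_nhds_in_open) auto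
    then show "\<forall>\<^sub>F h in nhds 0. (\<lambda>n. fps_nth (Abs_fps (\<lambda>n. tilted_moment (j + n) \<theta> / fact n)) n * h ^ n) sums tilted_moment j (\<theta> + h)"
      by eventually_elim (use * in auto)
  qed
qed

lemma tilted_moment_analytic: "real_analytic_on (tilted_moment j) (Theta \<mu>)"
  unfolding real_analytic_on_def using tilted_moment_fps_expansion by blast

lemma tilted_moment_deriv:
  assumes "\<theta> \<in> Theta \<mu>"
  shows "(tilted_moment j has_real_derivative tilted_moment (Suc j) \<theta>) (at \<theta>)"
  using fps_expansion_imp_has_derivative[OF tilted_moment_fps_expansion[OF assms, of j]] by simp

text \<open>
  Positivity is the one place where it matters that \<open>\<mu>\<close> is not concentrated on a point.
\<close>

lemma integral_quadratic_pos:
  assumes "\<theta> \<in> Theta \<mu>"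
  shows "(LINT x|\<mu>. (x - c) ^ 2 * exp (\<theta> * x)) > 0"
    and "(LINT x|\<mu>. (x - c) ^ 2 * exp (\<theta> * x)) = tilted_moment 2 \<theta> - 2 * c * tilted_moment 1 \<theta> + c ^ 2 * tilted_moment 0 \<theta>"
proof -
  note int = integrable_power_exp[OF assms]
  have eq: "(x - c) ^ 2 * exp (\<theta> * x) = x ^ 2 * exp (\<theta> * x) - 2 * c * (x ^ 1 * exp (\<theta> * x)) + c ^ 2 * (x ^ 0 * exp (\<theta> * x))" for x
    by (simp add: power2_eq_square algebra_simps)
  show "(LINT x|\<mu>. (x - c) ^ 2 * exp (\<theta> * x)) = tilted_moment 2 \<theta> - 2 * c * tilted_moment 1 \<theta> + c ^ 2 * tilted_moment 0 \<theta>"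
    unfolding eq tilted_moment_def using int[of 0] int[of 1] int[of 2] by simp
  have "integrable \<mu> (\<lambda>x. (x - c) ^ 2 * exp (\<theta> * x))"
    unfolding eq by (intro Bochner_Integration.integrable_add Bochner_Integration.integrable_diff integrable_mult_right int)
  then have "(LINT x|\<mu>. (x - c) ^ 2 * exp (\<theta> * x)) = 0 \<longleftrightarrow> (AE x in \<mu>. (x - c) ^ 2 * exp (\<theta> * x) = 0)"
    by (intro integral_nonneg_eq_0_iff_AE) auto
  also have "\<dots> \<longleftrightarrow> (AE x in \<mu>. x = c)"
    by simp
  finally have "(LINT x|\<mu>. (x - c) ^ 2 * exp (\<theta> * x)) \<noteq> 0"
    using not_degenerate by blast
  moreover have "(LINT x|\<mu>. (x - c) ^ 2 * exp (\<theta> * x)) \<ge> 0"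
    by (intro Bochner_Integration.integral_nonneg) auto
  ultimately show "(LINT x|\<mu>. (x - c) ^ 2 * exp (\<theta> * x)) > 0"
    by linarith
qed

lemma tilted_moment_0_pos:
  assumes "\<theta> \<in> Theta \<mu>"
  shows "tilted_moment 0 \<theta> > 0"
proof -
  have int: "integrable \<mu> (\<lambda>x. exp (\<theta> * x))"
    using integrable_power_exp[OF assms, of 0] by simp
  have "tilted_moment 0 \<theta> = 0 \<longleftrightarrow> (AE x in \<mu>. exp (\<theta> * x) = 0)"
    unfolding tilted_moment_def using int by (simp add: integral_nonneg_eq_0_iff_AE)
  also have "\<dots> \<longleftrightarrow> emeasure \<mu> (space \<mu>) = 0"
    using AE_iff_measurable[of "space \<mu>" \<mu> "\<lambda>x. False"] by simp
  finally have "tilted_moment 0 \<theta> \<noteq> 0"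
    using mass_one by simp
  moreover have "tilted_moment 0 \<theta> \<ge> 0"
    unfolding tilted_moment_def by (intro Bochner_Integration.integral_nonneg) auto
  ultimately show ?thesis
    by linarith
qed

lemma cumulant_eq:
  assumes "\<theta> \<in> Theta \<mu>"
  shows "cumulant \<mu> \<theta> = ln (tilted_moment 0 \<theta>)"
proof -
  have "integrable \<mu> (\<lambda>x. exp (\<theta> * x))"
    using integrable_power_exp[OF assms, of 0] by simp
  then have "laplace \<mu> \<theta> = ennreal (tilted_moment 0 \<theta>)"
    unfolding laplace_def tilted_moment_def by (subst nn_integral_eq_integral) auto
  then show ?thesis
    using tilted_moment_0_pos[OF assms] by (simp add: cumulant_def)
qed

definition tilted_mean :: "real \<Rightarrow> real" where
  "tilted_mean \<theta> = tilted_moment 1 \<theta> / tilted_moment 0 \<theta>"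

lemma deriv_cumulant:
  assumes "\<theta> \<in> Theta \<mu>"
  shows "deriv (cumulant \<mu>) \<theta> = tilted_mean \<theta>"
proof (rule DERIV_imp_deriv)
  have "((\<lambda>\<theta>. ln (tilted_moment 0 \<theta>)) has_real_derivative tilted_mean \<theta>) (at \<theta>)"
    using tilted_moment_0_pos[OF assms] unfolding tilted_mean_def
    by (auto intro!: derivative_eq_intros tilted_moment_deriv assms simp: field_simps)
  moreover have "eventually (\<lambda>\<theta>. \<theta> \<in> Theta \<mu>) (nhds \<theta>)"
    using open_Theta assms by (rule eventually_nhds_in_open)
  then have "eventually (\<lambda>\<theta>. ln (tilted_moment 0 \<theta>) = cumulant \<mu> \<theta>) (nhds \<theta>)"
    by eventually_elim (simp add: cumulant_eq)
  ultimately show "(cumulant \<mu> has_real_derivative tilted_mean \<theta>) (at \<theta>)"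
    by (subst DERIV_cong_ev[symmetric]) auto
qed

definition tilted_variance :: "real \<Rightarrow> real" where
  "tilted_variance \<theta> = tilted_moment 2 \<theta> / tilted_moment 0 \<theta> - (tilted_mean \<theta>) ^ 2"

lemma tilted_mean_deriv:
  assumes "\<theta> \<in> Theta \<mu>"
  shows "(tilted_mean has_real_derivative tilted_variance \<theta>) (at \<theta>)"
proof -
  have "((\<lambda>\<theta>. tilted_moment 1 \<theta> / tilted_moment 0 \<theta>) has_real_derivative tilted_variance \<theta>) (at \<theta>)"
    using tilted_moment_0_pos[OF assms] unfolding tilted_variance_def tilted_mean_def
    by (auto intro!: derivative_eq_intros tilted_moment_deriv assms simp: field_simps power2_eq_square numeral_2_eq_2)
  then show ?thesis
    by (simp add: tilted_mean_def[abs_def])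
qed

lemma tilted_variance_pos:
  assumes "\<theta> \<in> Theta \<mu>"
  shows "tilted_variance \<theta> > 0"
proof -
  have "tilted_moment 2 \<theta> - 2 * tilted_mean \<theta> * tilted_moment 1 \<theta> + (tilted_mean \<theta>) ^ 2 * tilted_moment 0 \<theta> > 0"
    using integral_quadratic_pos[OF assms, of "tilted_mean \<theta>"] by simp
  also have "tilted_moment 2 \<theta> - 2 * tilted_mean \<theta> * tilted_moment 1 \<theta> + (tilted_mean \<theta>) ^ 2 * tilted_moment 0 \<theta> = tilted_variance \<theta> * tilted_moment 0 \<theta>"
    using tilted_moment_0_pos[OF assms] by (simp add: tilted_variance_def tilted_mean_def field_simps power2_eq_square)
  finally show ?thesis
    using tilted_moment_0_pos[OF assms] by (simp add: zero_less_mult_iff)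
qed

lemma tilted_mean_strict_mono:
  assumes "a \<in> Theta \<mu>" "b \<in> Theta \<mu>" "a < b"
  shows "tilted_mean a < tilted_mean b"
  using assms(3)
proof (rule DERIV_pos_imp_increasing)
  fix x assume "a \<le> x" "x \<le> b"
  with assms have "x \<in> Theta \<mu>"
    using Theta_between by blast
  then show "\<exists>y. (tilted_mean has_real_derivative y) (at x) \<and> 0 < y"
    using tilted_mean_deriv tilted_variance_pos by blast
qed

lemma psi_tilted_mean:
  assumes "\<theta> \<in> Theta \<mu>"
  shows "psi \<mu> (tilted_mean \<theta>) = \<theta>"
proof -
  have "inj_on (deriv (cumulant \<mu>)) (Theta \<mu>)"
    using tilted_mean_strict_mono by (intro inj_onI) (metis deriv_cumulant less_irrefl linorder_neqE)
  from the_inv_into_f_f[OF this assms] show ?thesis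
    by (simp add: psi_def deriv_cumulant[OF assms])
qed

lemma means_domain_eq: "means_domain \<mu> = tilted_mean ` Theta \<mu>"
  unfolding means_domain_def by (rule image_cong) (simp_all add: deriv_cumulant)

lemma tilted_mean_analytic: "real_analytic_on tilted_mean (Theta \<mu>)"
  using real_analytic_on_divide[OF tilted_moment_analytic[of 1] tilted_moment_analytic[of 0]] tilted_moment_0_pos
  by (simp add: tilted_mean_def[abs_def] less_imp_neq[symmetric])

lemma cumulant_analytic: "real_analytic_on (cumulant \<mu>) (Theta \<mu>)"
proof (rule real_analytic_on_singleton_imp)
  fix \<theta> assume \<theta>: "\<theta> \<in> Theta \<mu>"
  have "real_analytic_on (\<lambda>\<theta>. ln (tilted_moment 0 \<theta>)) {\<theta>}"
  proof (rule real_analytic_on_compose[of ln "tilted_moment 0"])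
    show "real_analytic_on ln (tilted_moment 0 ` {\<theta>})"
      using \<theta> tilted_moment_0_pos by (intro real_analytic_on_ln) auto
    show "real_analytic_on (tilted_moment 0) {\<theta>}"
      using tilted_moment_analytic by (rule real_analytic_on_subset) (use \<theta> in auto)
  qed
  moreover have "eventually (\<lambda>\<theta>. \<theta> \<in> Theta \<mu>) (nhds \<theta>)"
    using open_Theta \<theta> by (rule eventually_nhds_in_open)
  then have "eventually (\<lambda>\<theta>. ln (tilted_moment 0 \<theta>) = cumulant \<mu> \<theta>) (nhds \<theta>)"
    by eventually_elim (simp add: cumulant_eq)
  ultimately show "real_analytic_on (cumulant \<mu>) {\<theta>}"
    by (rule real_analytic_on_transfer)
qed

end

section \<open>Consequences of an exponential generating function\<close>

lemma fps_of_poly_expansion_imp_eq: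
  assumes "f has_fps_expansion F" "F = fps_of_poly p"
  shows "eventually (\<lambda>z. f z = poly p z) (nhds (0::real))"
  using assms by (auto simp: has_fps_expansion_def elim: eventually_mono)

lemma poly_degree_1: "degree (p :: real poly) = 1 \<Longrightarrow> poly p x = coeff p 0 + coeff p 1 * x"
  by (simp add: poly_altdef)

lemma exponential_form_center:
  assumes "exponential_form Q r a b" "Q 0 = 1"
  shows "a 0 = 0" "b 0 = 0"
proof -
  have *: "a 0 * x + b 0 = 0" for x
  proof -
    have "(\<lambda>n. poly (Q n) x * (0 ^ n / fact n)) sums exp (a 0 * x + b 0)"
      using assms(1) by (simp add: exponential_form_def)
    moreover have "(\<lambda>n. poly (Q n) x * (0 ^ n / fact n)) sums (\<Sum>n\<in>{0}. poly (Q n) x * (0 ^ n / fact n))"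
      by (rule sums_finite) auto
    ultimately show ?thesis
      using assms(2) sums_unique2 by fastforce
  qed
  from *[of 0] *[of 1] show "a 0 = 0" "b 0 = 0" by auto
qed

text \<open>
  As \<open>a 0 = 0\<close>, only the powers \<open>A ^ i\<close> with \<open>i \<le> k\<close> contribute to the coefficient of \<open>z ^ k\<close> in
  \<open>exp (x * a z)\<close>. The sums on the right are therefore finite, which shows \<open>Q n\<close> as an explicit
  combination of monomials.
\<close>

lemma exponential_form_coefficients:
  assumes form: "exponential_form Q r a b" and Q0: "Q 0 = 1"
    and A: "a has_fps_expansion A" and B: "b has_fps_expansion B"
  shows "poly (Q n) x / fact n =
    (\<Sum>k=0..n. (\<Sum>i=0..k. x ^ i / fact i * fps_nth (A ^ i) k) * fps_nth (fps_exp 1 oo B) (n - k))"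
proof -
  note zero = exponential_form_center[OF form Q0]
  have A0: "fps_nth A 0 = 0" and B0: "fps_nth B 0 = 0"
    using has_fps_expansion_nth_0[OF A] has_fps_expansion_nth_0[OF B] zero by auto
  have "(\<lambda>z. exp (x * a z) * exp (1 * b z)) has_fps_expansion (fps_exp x oo A) * (fps_exp 1 oo B)"
    by (intro has_fps_expansion_mult has_fps_expansion_compose_real[OF has_fps_expansion_exp] A B A0 B0)
  moreover have "(\<lambda>z. exp (x * a z) * exp (1 * b z)) has_fps_expansion Abs_fps (\<lambda>n. poly (Q n) x / fact n)"
  proof (rule has_fps_expansionI)
    have "eventually (\<lambda>z. z \<in> {-r<..<r}) (nhds 0)"
      using form by (intro eventually_nhds_in_open) (auto simp: exponential_form_def)
    then show "\<forall>\<^sub>F z in nhds 0. (\<lambda>n. fps_nth (Abs_fps (\<lambda>n. poly (Q n) x / fact n)) n * z ^ n)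
        sums (exp (x * a z) * exp (1 * b z))"
    proof eventually_elim
      case (elim z)
      then have "(\<lambda>n. poly (Q n) x * (z ^ n / fact n)) sums exp (a z * x + b z)"
        using form by (simp add: exponential_form_def)
      then show ?case
        by (simp add: exp_add mult.commute)
    qed
  qed
  ultimately have "(fps_exp x oo A) * (fps_exp 1 oo B) = Abs_fps (\<lambda>n. poly (Q n) x / fact n)"
    by (rule fps_expansion_unique_real)
  then have "fps_nth ((fps_exp x oo A) * (fps_exp 1 oo B)) n = poly (Q n) x / fact n"
    by simp
  then show ?thesis
    by (simp add: fps_mult_nth fps_compose_nth[of "fps_exp x"])
qed

context nef_generator
begin

text \<open>
  The unnormalized integral of the polynomial \<open>p\<close> under the member with parameter \<open>\<theta>\<close>.
\<close>

definition poly_moment :: "real poly \<Rightarrow> real \<Rightarrow> real" where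
  "poly_moment p \<theta> = (\<Sum>j\<le>degree p. coeff p j * tilted_moment j \<theta>)"

lemma integrable_power: "integrable \<mu> (\<lambda>x. x ^ j)"
  using integrable_power_exp[OF zero_in_Theta, of j] by simp

lemma tilted_moment_zero: "tilted_moment j 0 = (LINT x|\<mu>. x ^ j)"
  by (simp add: tilted_moment_def)

text \<open>
  Integrating the finite sums for \<open>Q n\<close> replaces the monomial \<open>x ^ i\<close> by the moment
  \<open>tilted_moment (j + i) 0\<close>. This turns the exponential series in \<open>a\<close> into the Taylor series of
  \<open>tilted_moment j\<close>, composed with \<open>a\<close>.
\<close>

lemma integral_power_mult_exponential:
  assumes form: "exponential_form Q r a b" and Q0: "Q 0 = 1"
    and A: "a has_fps_expansion A" and B: "b has_fps_expansion B"
  shows "(LINT x|\<mu>. x ^ j * poly (Q n) x) / fact n =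
    fps_nth ((Abs_fps (\<lambda>i. tilted_moment (j + i) 0 / fact i) oo A) * (fps_exp 1 oo B)) n"
    and "integrable \<mu> (\<lambda>x. x ^ j * poly (Q n) x)"
proof -
  let ?c = "\<lambda>k i. fps_nth (A ^ i) k * fps_nth (fps_exp 1 oo B) (n - k) / fact i"
  have *: "x ^ j * poly (Q n) x = fact n * (\<Sum>k=0..n. \<Sum>i=0..k. ?c k i * x ^ (j + i))" for x
  proof -
    have "x ^ j * poly (Q n) x = fact n * (x ^ j * (poly (Q n) x / fact n))"
      by simp
    also have "x ^ j * (poly (Q n) x / fact n) = (\<Sum>k=0..n. \<Sum>i=0..k. ?c k i * x ^ (j + i))"
      unfolding exponential_form_coefficients[OF assms]
      by (simp add: sum_distrib_left sum_distrib_right power_add mult_ac)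
    finally show ?thesis .
  qed
  show "integrable \<mu> (\<lambda>x. x ^ j * poly (Q n) x)"
    unfolding * by (intro integrable_mult_right Bochner_Integration.integrable_sum integrable_power)
  have "(LINT x|\<mu>. x ^ j * poly (Q n) x) = fact n * (\<Sum>k=0..n. \<Sum>i=0..k. ?c k i * tilted_moment (j + i) 0)"
    unfolding * tilted_moment_zero
    by (simp add: Bochner_Integration.integral_sum integrable_power)
  moreover have "fps_nth ((Abs_fps (\<lambda>i. tilted_moment (j + i) 0 / fact i) oo A) * (fps_exp 1 oo B)) n
      = (\<Sum>k=0..n. \<Sum>i=0..k. ?c k i * tilted_moment (j + i) 0)"
    unfolding fps_mult_nth by (simp add: fps_compose_nth[of "Abs_fps _"] sum_distrib_left sum_distrib_right mult_ac)
  ultimately show "(LINT x|\<mu>. x ^ j * poly (Q n) x) / fact n =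
    fps_nth ((Abs_fps (\<lambda>i. tilted_moment (j + i) 0 / fact i) oo A) * (fps_exp 1 oo B)) n"
    by simp
qed

text \<open>
  Read for \<open>z\<close> near \<open>0\<close>, the left side is the integral of \<open>p\<close> times the generating function. So this
  is the termwise integration of the generating function against \<open>p\<close>.
\<close>

lemma poly_moment_fps_expansion:
  assumes form: "exponential_form Q r a b" and Q0: "Q 0 = 1"
  shows "(\<lambda>z. exp (b z) * poly_moment p (a z)) has_fps_expansion
    Abs_fps (\<lambda>n. (LINT x|\<mu>. poly (Q n) x * poly p x) / fact n)"
proof -
  have "real_analytic_on a {0}" "real_analytic_on b {0}"
    using form by (auto simp: exponential_form_def elim!: real_analytic_on_subset)
  then obtain A B where A: "a has_fps_expansion A" and B: "b has_fps_expansion B"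
    by (auto simp: real_analytic_on_def)
  note zero = exponential_form_center[OF form Q0]
  have A0: "fps_nth A 0 = 0" and B0: "fps_nth B 0 = 0"
    using has_fps_expansion_nth_0[OF A] has_fps_expansion_nth_0[OF B] zero by auto
  let ?G = "\<lambda>j. (Abs_fps (\<lambda>i. tilted_moment (j + i) 0 / fact i) oo A) * (fps_exp 1 oo B)"
  have "(\<lambda>h. tilted_moment j h) has_fps_expansion Abs_fps (\<lambda>n. tilted_moment (j + n) 0 / fact n)" for j
    using tilted_moment_fps_expansion[OF zero_in_Theta, of j] by simp
  then have "(\<lambda>z. tilted_moment j (a z) * exp (1 * b z)) has_fps_expansion ?G j" for j
    by (intro has_fps_expansion_mult has_fps_expansion_compose_real[OF has_fps_expansion_exp]
      has_fps_expansion_compose_real[of "tilted_moment j"] A B A0 B0)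
  then have "(\<lambda>z. \<Sum>j\<le>degree p. coeff p j * (tilted_moment j (a z) * exp (1 * b z))) has_fps_expansion
      (\<Sum>j\<le>degree p. fps_const (coeff p j) * ?G j)"
    by (intro has_fps_expansion_sum has_fps_expansion_cmult_left)
  also have "(\<lambda>z. \<Sum>j\<le>degree p. coeff p j * (tilted_moment j (a z) * exp (1 * b z)))
      = (\<lambda>z. exp (b z) * poly_moment p (a z))"
    by (simp add: poly_moment_def sum_distrib_left mult_ac)
  also have "(\<Sum>j\<le>degree p. fps_const (coeff p j) * ?G j)
      = Abs_fps (\<lambda>n. (LINT x|\<mu>. poly (Q n) x * poly p x) / fact n)"
  proof (rule fps_ext)
    fix n
    have "(LINT x|\<mu>. poly (Q n) x * poly p x) = (LINT x|\<mu>. (\<Sum>j\<le>degree p. coeff p j * (x ^ j * poly (Q n) x)))"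
      by (simp add: poly_altdef[of p] sum_distrib_left mult_ac)
    also have "\<dots> = (\<Sum>j\<le>degree p. coeff p j * (LINT x|\<mu>. x ^ j * poly (Q n) x))"
      using integral_power_mult_exponential(2)[OF form Q0 A B] by (simp add: Bochner_Integration.integral_sum)
    finally have "(LINT x|\<mu>. poly (Q n) x * poly p x) / fact n
      = (\<Sum>j\<le>degree p. coeff p j * ((LINT x|\<mu>. x ^ j * poly (Q n) x) / fact n))"
      by (simp add: sum_divide_distrib)
    then show "fps_nth (\<Sum>j\<le>degree p. fps_const (coeff p j) * ?G j) n
      = fps_nth (Abs_fps (\<lambda>n. (LINT x|\<mu>. poly (Q n) x * poly p x) / fact n)) n"
      unfolding integral_power_mult_exponential(1)[OF form Q0 A B] by (simp add: fps_sum_nth)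
  qed
  finally show ?thesis .
qed

lemma tilted_mean_zero:
  assumes "has_bochner_integral \<mu> (\<lambda>x. x) m"
  shows "tilted_mean 0 = m"
proof -
  have "(LINT x|\<mu>. x) = m"
    using assms by (rule has_bochner_integral_integral_eq)
  moreover have "measure \<mu> (space \<mu>) = 1"
    using mass_one by (simp add: measure_def)
  ultimately show ?thesis
    by (simp add: tilted_mean_def tilted_moment_def)
qed

text \<open>
  Termwise integration against \<open>1\<close>, \<open>Q 1\<close> and \<open>Q 2\<close>. By 2-orthogonality the resulting series are
  the constant \<open>1\<close>, a multiple of \<open>z\<close>, and a combination of \<open>z ^ 2\<close> and \<open>z ^ 3\<close>. Solving for the
  moments of order up to two gives the normalization, the mean and the variance at \<open>a z\<close>.
\<close>

lemma exponential_form_relations: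
  assumes form: "exponential_form Q r a b" and Q0: "Q 0 = 1"
    and orth: "two_orthogonal \<mu> Q" and deg: "\<And>n. degree (Q n) = n"
  obtains t V where "t \<noteq> 0" "eventually (\<lambda>z. a z \<in> Theta \<mu> \<and> exp (b z) * tilted_moment 0 (a z) = 1
    \<and> tilted_mean (a z) = t * z + tilted_mean 0 \<and> tilted_variance (a z) = poly V (t * z + tilted_mean 0)) (nhds 0)"
proof -
  let ?I = "\<lambda>n p. LINT x|\<mu>. poly (Q n) x * poly p x"
  have mass: "measure \<mu> (space \<mu>) = 1"
    using mass_one by (simp add: measure_def)
  have I_zero: "?I n (Q q) = 0" if "n \<ge> 1" "q \<ge> 1" "n \<ge> 2 * q" for n q
    using orth that unfolding two_orthogonal_def by blast
  have I_one: "(LINT x|\<mu>. poly (Q n) x) = 0" if "n \<ge> 1" for n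
    using orth that unfolding two_orthogonal_def by blast
  have poly_1_fun: "poly 1 = (\<lambda>x::real. 1::real)"
    by (rule ext) simp
  note zero = exponential_form_center[OF form Q0]

  have Th: "eventually (\<lambda>z. a z \<in> Theta \<mu>) (nhds 0)"
  proof -
    have "isCont a 0"
      using form by (intro real_analytic_on_imp_isCont[of a "{-r<..<r}"]) (auto simp: exponential_form_def)
    then have "filterlim a (nhds 0) (nhds 0)"
      using tendsto_at_iff_tendsto_nhds[of a 0] zero by (simp add: isCont_def)
    from eventually_compose_filterlim[OF eventually_nhds_in_open[OF open_Theta zero_in_Theta] this]
    show ?thesis .
  qed

  have "Abs_fps (\<lambda>n. ?I n 1 / fact n) = fps_of_poly [:1:]"
  proof (rule fps_ext)
    fix n
    show "fps_nth (Abs_fps (\<lambda>n. ?I n 1 / fact n)) n = fps_nth (fps_of_poly [:1:]) n"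
      using I_one[of n] by (cases n) (simp_all add: Q0 mass poly_1_fun)
  qed
  from fps_of_poly_expansion_imp_eq[OF poly_moment_fps_expansion[OF form Q0] this]
  have 0: "eventually (\<lambda>z. exp (b z) * tilted_moment 0 (a z) = 1) (nhds 0)"
    by (simp add: poly_moment_def)

  define s where "s = coeff (Q 1) 1"
  define u where "u = coeff (Q 1) 0"
  have s: "s \<noteq> 0"
    using deg[of 1] leading_coeff_0_iff[of "Q 1"] by (auto simp: s_def)
  have Q1: "poly (Q 1) x = u + s * x" for x
    unfolding s_def u_def by (rule poly_degree_1) (rule deg)
  define c1 where "c1 = ?I 1 (Q 1)"
  have "Abs_fps (\<lambda>n. ?I n (Q 1) / fact n) = fps_of_poly [:0, c1:]"
  proof (rule fps_ext)
    fix n :: nat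
    consider "n = 0" | "n = 1" | "n \<ge> 2" by linarith
    then show "fps_nth (Abs_fps (\<lambda>n. ?I n (Q 1) / fact n)) n = fps_nth (fps_of_poly [:0, c1:]) n"
    proof cases
      case 3
      then show ?thesis
        using I_zero[of n 1] by (simp add: coeff_eq_0)
    qed (use I_one[of 1] Q0 in \<open>simp_all add: c1_def\<close>)
  qed
  from fps_of_poly_expansion_imp_eq[OF poly_moment_fps_expansion[OF form Q0] this]
  have 1: "eventually (\<lambda>z. exp (b z) * (u * tilted_moment 0 (a z) + s * tilted_moment 1 (a z)) = c1 * z) (nhds 0)"
    by (simp add: poly_moment_def deg u_def s_def mult.commute)
  have mean1: "eventually (\<lambda>z. u + s * tilted_mean (a z) = c1 * z) (nhds 0)"
    using Th 0 1
  proof eventually_elim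
    case (elim z)
    then have "exp (b z) = 1 / tilted_moment 0 (a z)"
      using tilted_moment_0_pos[of "a z"] by (simp add: field_simps)
    with elim show ?case
      using tilted_moment_0_pos[of "a z"] by (simp add: tilted_mean_def field_simps)
  qed
  from eventually_nhds_x_imp_x[OF this] have u: "u = - s * tilted_mean 0"
    by (simp add: zero)
  have "c1 = (LINT x|\<mu>. s ^ 2 * ((x - tilted_mean 0) ^ 2 * exp (0 * x)))"
    unfolding c1_def Q1 u by (intro Bochner_Integration.integral_cong) (auto simp: power2_eq_square algebra_simps)
  also have "\<dots> = s ^ 2 * (LINT x|\<mu>. (x - tilted_mean 0) ^ 2 * exp (0 * x))"
    by simp
  finally have c1: "c1 > 0"
    using integral_quadratic_pos(1)[OF zero_in_Theta, of "tilted_mean 0"] s by simp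
  \<comment> \<open>The slope of the mean is \<open>c1 / s = s * tilted_variance 0\<close>, which is nonzero.\<close>
  define t where "t = c1 / s"
  have t: "t \<noteq> 0"
    using c1 s by (simp add: t_def)
  have mean: "eventually (\<lambda>z. tilted_mean (a z) = t * z + tilted_mean 0) (nhds 0)"
    using mean1 by eventually_elim (use s u in \<open>simp add: t_def field_simps\<close>)

  define q0 q1 q2 where "q0 = coeff (Q 2) 0" and "q1 = coeff (Q 2) 1" and "q2 = coeff (Q 2) 2"
  have q2: "q2 \<noteq> 0"
    using deg[of 2] leading_coeff_0_iff[of "Q 2"] by (auto simp: q2_def)
  define C where "C = [:0, 0, ?I 2 (Q 2) / 2, ?I 3 (Q 2) / 6:]"
  have "Abs_fps (\<lambda>n. ?I n (Q 2) / fact n) = fps_of_poly C"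
  proof (rule fps_ext)
    fix n :: nat
    consider "n = 0" | "n = 1" | "n = 2" | "n = 3" | "n \<ge> 4" by linarith
    then show "fps_nth (Abs_fps (\<lambda>n. ?I n (Q 2) / fact n)) n = fps_nth (fps_of_poly C) n"
    proof cases
      case 2
      then show ?thesis
        using I_zero[of 2 1] by (simp add: C_def mult.commute)
    next
      case 5
      have "degree C \<le> 3"
        by (simp add: C_def)
      with 5 have "coeff C n = 0"
        by (intro coeff_eq_0) simp
      then show ?thesis
        using I_zero[of n 2] 5 by simp
    qed (use I_one[of 2] Q0 in \<open>simp_all add: C_def numeral_2_eq_2 numeral_3_eq_3\<close>)
  qed
  from fps_of_poly_expansion_imp_eq[OF poly_moment_fps_expansion[OF form Q0] this]
  have 2: "eventually (\<lambda>z. exp (b z) * (q0 * tilted_moment 0 (a z) + q1 * tilted_moment 1 (a z) + q2 * tilted_moment 2 (a z)) = poly C z) (nhds 0)"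
    by (simp add: poly_moment_def deg q0_def q1_def q2_def numeral_2_eq_2)
  \<comment> \<open>Solve \<open>Q 2\<close> for the second moment, substitute \<open>z = (m - tilted_mean 0) / t\<close>, and subtract \<open>m ^ 2\<close>.\<close>
  define V where "V = smult (1 / q2) (pcompose C [:- tilted_mean 0 / t, 1 / t:] - [:q0, q1:]) - [:0, 0, 1:]"
  have var: "eventually (\<lambda>z. tilted_variance (a z) = poly V (t * z + tilted_mean 0)) (nhds 0)"
    using Th 0 2 mean
  proof eventually_elim
    case (elim z)
    then have pos: "tilted_moment 0 (a z) > 0"
      using tilted_moment_0_pos by blast
    with elim have "exp (b z) = 1 / tilted_moment 0 (a z)"
      by (simp add: field_simps)
    with elim(3) pos have "poly C z = q0 + q1 * tilted_mean (a z) + q2 * (tilted_moment 2 (a z) / tilted_moment 0 (a z))"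
      by (simp add: tilted_mean_def field_simps)
    then have "tilted_moment 2 (a z) / tilted_moment 0 (a z) = (poly C z - q0 - q1 * tilted_mean (a z)) / q2"
      using q2 by (simp add: field_simps)
    moreover have "- tilted_mean 0 / t + (t * z + tilted_mean 0) / t = z"
      using t by (simp add: field_simps)
    ultimately show ?case
      unfolding tilted_variance_def V_def elim(4) by (simp add: poly_pcompose power2_eq_square algebra_simps diff_divide_distrib add_divide_distrib)
  qed
  show ?thesis
    by (rule that[OF t]) (use Th 0 mean var in eventually_elim, blast)
qed

end

section \<open>Growth of moments under a polynomial variance function\<close>

text \<open>
  A norm on polynomials that dominates the supremum on \<open>[-B, B]\<close>, is submultiplicative, and under
  which differentiation costs only the degree divided by \<open>B\<close>.
\<close>

definition poly_abs :: "real \<Rightarrow> real poly \<Rightarrow> real" where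
  "poly_abs B p = poly (map_poly abs p) B"

lemma poly_abs_0 [simp]: "poly_abs B 0 = 0"
  by (simp add: poly_abs_def)

lemma poly_abs_pCons [simp]: "poly_abs B (pCons c p) = \<bar>c\<bar> + B * poly_abs B p"
  by (simp add: poly_abs_def map_poly_pCons)

lemma poly_abs_nonneg: "B \<ge> 0 \<Longrightarrow> poly_abs B p \<ge> 0"
  by (induction p) auto

lemma abs_poly_le_poly_abs:
  assumes "\<bar>x\<bar> \<le> B"
  shows "\<bar>poly p x\<bar> \<le> poly_abs B p"
proof (induction p)
  case (pCons c p)
  have "\<bar>x * poly p x\<bar> \<le> B * poly_abs B p"
    unfolding abs_mult using assms pCons.IH by (intro mult_mono) auto
  then show ?case
    by simp
qed simp

lemma poly_abs_add:
  assumes "B \<ge> 0"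
  shows "poly_abs B (p + q) \<le> poly_abs B p + poly_abs B q"
proof (induction p q rule: poly_induct2)
  case (pCons c p d q)
  then have "B * poly_abs B (p + q) \<le> B * (poly_abs B p + poly_abs B q)"
    using assms by (intro mult_left_mono)
  then show ?case
    using abs_triangle_ineq[of c d] by (simp add: distrib_left)
qed simp

lemma poly_abs_smult: "poly_abs B (smult c p) = \<bar>c\<bar> * poly_abs B p"
  by (induction p) (simp_all add: abs_mult algebra_simps)

lemma poly_abs_mult:
  assumes "B \<ge> 0"
  shows "poly_abs B (p * q) \<le> poly_abs B p * poly_abs B q"
proof (induction p)
  case (pCons c p)
  have "poly_abs B (pCons c p * q) \<le> \<bar>c\<bar> * poly_abs B q + B * poly_abs B (p * q)"
    using poly_abs_add[OF assms, of "smult c q" "pCons 0 (p * q)"] by (simp add: poly_abs_smult)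
  also have "B * poly_abs B (p * q) \<le> B * (poly_abs B p * poly_abs B q)"
    using assms pCons.IH by (intro mult_left_mono)
  finally show ?case
    by (simp add: algebra_simps)
qed simp

lemma poly_abs_pderiv:
  assumes "B \<ge> 0"
  shows "B * poly_abs B (pderiv p) \<le> degree p * poly_abs B p"
proof (induction p)
  case (pCons c p)
  show ?case
  proof (cases "p = 0")
    case False
    have "poly_abs B (pderiv (pCons c p)) \<le> poly_abs B p + B * poly_abs B (pderiv p)"
      using poly_abs_add[OF assms, of p "pCons 0 (pderiv p)"] by (simp add: pderiv_pCons)
    also have "\<dots> \<le> (degree p + 1) * poly_abs B p"
      using pCons.IH by (simp add: algebra_simps)
    finally have "B * poly_abs B (pderiv (pCons c p)) \<le> B * ((degree p + 1) * poly_abs B p)"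
      using assms by (intro mult_left_mono)
    also have "\<dots> \<le> (degree p + 1) * (\<bar>c\<bar> + B * poly_abs B p)"
      by (simp add: algebra_simps)
    finally show ?thesis
      using False by (simp add: algebra_simps)
  qed (simp add: pderiv_pCons)
qed simp

text \<open>
  Differentiation in \<open>\<theta>\<close> acts on functions of the mean \<open>m\<close> as \<open>V * d/dm\<close>, since the derivative of the
  mean is the variance. Multiplying the normalized \<open>n\<close>-th moment by the Laplace transform and
  differentiating yields this recursion for the next moment.
\<close>

primrec moment_poly :: "real poly \<Rightarrow> nat \<Rightarrow> real poly" where
  "moment_poly V 0 = 1"
| "moment_poly V (Suc n) = [:0, 1:] * moment_poly V n + V * pderiv (moment_poly V n)"

lemma degree_moment_poly: "degree (moment_poly V n) \<le> n * (degree V + 1)"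
proof (induction n)
  case (Suc n)
  have "degree ([:0, 1:] * moment_poly V n) \<le> degree (moment_poly V n) + 1"
    using degree_mult_le[of "[:0, 1:]" "moment_poly V n"] by simp
  moreover have "degree (V * pderiv (moment_poly V n)) \<le> degree V + degree (moment_poly V n)"
    using degree_mult_le[of V "pderiv (moment_poly V n)"] degree_pderiv[of "moment_poly V n"] by linarith
  ultimately have "degree (moment_poly V (Suc n)) \<le> degree (moment_poly V n) + (degree V + 1)"
    by (auto intro!: degree_add_le simp del: mult_pCons_left)
  with Suc.IH show ?case
    by simp
qed simp

text \<open>
  The degree grows by a bounded amount in each step, so the \<open>n\<close>-th differentiation costs a factor
  proportional to \<open>n\<close>. This is the source of the factorial; the growth is no worse than for the
  Taylor coefficients of an analytic function.
\<close>

lemma poly_abs_moment_poly: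
  assumes "B \<ge> 1"
  shows "poly_abs B (moment_poly V n) \<le> fact n * (B + poly_abs B V * (degree V + 1)) ^ n"
proof (induction n)
  case 0
  show ?case
    by (simp add: one_pCons)
next
  case (Suc n)
  define N where "N = poly_abs B (moment_poly V n)"
  define C where "C = B + poly_abs B V * (degree V + 1)"
  have N: "N \<ge> 0" and V: "poly_abs B V \<ge> 0"
    using assms by (auto simp: N_def intro: poly_abs_nonneg)
  have "poly_abs B (pderiv (moment_poly V n)) \<le> B * poly_abs B (pderiv (moment_poly V n))"
    using mult_right_mono[OF assms poly_abs_nonneg[of B "pderiv (moment_poly V n)"]] assms by simp
  also have "\<dots> \<le> degree (moment_poly V n) * N"
    using poly_abs_pderiv[of B] assms by (simp add: N_def)
  also have "\<dots> \<le> real (n * (degree V + 1)) * N"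
    using degree_moment_poly[of V n] N by (intro mult_right_mono) (simp_all only: of_nat_le_iff)
  finally have deriv: "poly_abs B (pderiv (moment_poly V n)) \<le> real (n * (degree V + 1)) * N" .
  have "poly_abs B (moment_poly V (Suc n))
      \<le> poly_abs B ([:0, 1:] * moment_poly V n) + poly_abs B (V * pderiv (moment_poly V n))"
    unfolding moment_poly.simps using assms by (intro poly_abs_add) simp
  also have "poly_abs B ([:0, 1:] * moment_poly V n) = B * N"
    by (simp add: N_def)
  also have "poly_abs B (V * pderiv (moment_poly V n)) \<le> poly_abs B V * poly_abs B (pderiv (moment_poly V n))"
    using assms by (intro poly_abs_mult) auto
  also have "\<dots> \<le> poly_abs B V * (real (n * (degree V + 1)) * N)"
    using V deriv by (intro mult_left_mono)
  also have "B * N + \<dots> \<le> real (Suc n) * C * N"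
  proof -
    have "0 \<le> n * B * N + poly_abs B V * (degree V + 1) * N"
      using N V assms by simp
    then show ?thesis
      by (simp add: C_def algebra_simps)
  qed
  also have "\<dots> \<le> real (Suc n) * C * (fact n * C ^ n)"
    using Suc.IH V assms by (intro mult_left_mono) (auto simp: N_def C_def)
  finally show ?case
    by (simp add: C_def algebra_simps)
qed

context nef_generator
begin

lemma tilted_variance_analytic: "real_analytic_on tilted_variance (Theta \<mu>)"
proof -
  have "real_analytic_on (\<lambda>\<theta>. tilted_moment 2 \<theta> / tilted_moment 0 \<theta> - tilted_mean \<theta> * tilted_mean \<theta>) (Theta \<mu>)"
    using tilted_moment_0_pos
    by (intro real_analytic_on_diff real_analytic_on_divide real_analytic_on_mult tilted_moment_analytic tilted_mean_analytic)
      (auto simp: less_imp_neq[symmetric])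
  then show ?thesis
    by (simp add: tilted_variance_def[abs_def] power2_eq_square)
qed

text \<open>
  The relation holds along the curve \<open>a\<close>, which accumulates at \<open>0\<close> without being constant, because
  the mean varies along it. The identity theorem does the rest.
\<close>

lemma variance_function_extends:
  assumes a: "isCont a 0" "a 0 = 0" and t: "t \<noteq> 0"
    and rel: "eventually (\<lambda>z. tilted_mean (a z) = t * z + tilted_mean 0 \<and> tilted_variance (a z) = poly V (t * z + tilted_mean 0)) (nhds 0)"
    and \<theta>: "\<theta> \<in> Theta \<mu>"
  shows "tilted_variance \<theta> = poly V (tilted_mean \<theta>)"
proof -
  define D where "D \<theta> = tilted_variance \<theta> - poly V (tilted_mean \<theta>)" for \<theta>
  have D: "real_analytic_on D (Theta \<mu>)"
    unfolding D_def by (intro real_analytic_on_diff tilted_variance_analytic real_analytic_on_poly tilted_mean_analytic)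
  have rel_at: "eventually (\<lambda>z. tilted_mean (a z) = t * z + tilted_mean 0 \<and> tilted_variance (a z) = poly V (t * z + tilted_mean 0)) (at 0)"
    using rel by (simp add: eventually_nhds_conv_at)
  have "frequently (\<lambda>\<theta>. D \<theta> = 0) (at 0)"
  proof (rule ccontr)
    assume "\<not> frequently (\<lambda>\<theta>. D \<theta> = 0) (at 0)"
    then have nz: "eventually (\<lambda>\<theta>. D \<theta> \<noteq> 0) (at 0)"
      by (simp add: frequently_def)
    have "eventually (\<lambda>z. a z \<noteq> 0) (at 0)"
      using rel_at eventually_neq_at_within[of 0 0 UNIV]
      by eventually_elim (use t in auto)
    moreover have "(a \<longlongrightarrow> 0) (at 0)"
      using a by (simp add: isCont_def)
    ultimately have "filterlim a (at 0) (at 0)"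
      by (simp add: filterlim_at)
    from eventually_compose_filterlim[OF nz this] rel_at
    have "eventually (\<lambda>z::real. False) (at 0)"
      by eventually_elim (simp add: D_def)
    then show False
      using at_neq_bot eventually_False by blast
  qed
  moreover have "real_analytic_on D {0}"
    using D by (rule real_analytic_on_subset) (use zero_in_Theta in auto)
  ultimately have "eventually (\<lambda>\<theta>. D \<theta> = 0) (nhds 0)"
    by (intro real_analytic_frequently_zero)
  from real_analytic_identity[OF D open_Theta connected_Theta zero_in_Theta this \<theta>]
  show ?thesis
    by (simp add: D_def)
qed

lemma tilted_moment_eq_moment_poly:
  assumes V: "\<And>\<theta>. \<theta> \<in> Theta \<mu> \<Longrightarrow> tilted_variance \<theta> = poly V (tilted_mean \<theta>)"
    and "\<theta> \<in> Theta \<mu>"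
  shows "tilted_moment n \<theta> = tilted_moment 0 \<theta> * poly (moment_poly V n) (tilted_mean \<theta>)"
  using assms(2)
proof (induction n arbitrary: \<theta>)
  case 0
  then show ?case
    by simp
next
  case (Suc n)
  let ?H = "moment_poly V n"
  have "((\<lambda>\<theta>. tilted_moment 0 \<theta> * poly ?H (tilted_mean \<theta>)) has_real_derivative
      tilted_moment 0 \<theta> * (poly (pderiv ?H) (tilted_mean \<theta>) * tilted_variance \<theta>) + tilted_moment (Suc 0) \<theta> * poly ?H (tilted_mean \<theta>)) (at \<theta>)"
    by (intro DERIV_mult' DERIV_chain2[OF poly_DERIV] tilted_moment_deriv tilted_mean_deriv Suc.prems)
  moreover have "eventually (\<lambda>\<theta>. \<theta> \<in> Theta \<mu>) (nhds \<theta>)"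
    using open_Theta Suc.prems by (rule eventually_nhds_in_open)
  then have "eventually (\<lambda>\<theta>. tilted_moment n \<theta> = tilted_moment 0 \<theta> * poly ?H (tilted_mean \<theta>)) (nhds \<theta>)"
    by eventually_elim (rule Suc.IH)
  ultimately have "(tilted_moment n has_real_derivative
      tilted_moment 0 \<theta> * (poly (pderiv ?H) (tilted_mean \<theta>) * tilted_variance \<theta>) + tilted_moment (Suc 0) \<theta> * poly ?H (tilted_mean \<theta>)) (at \<theta>)"
    by (subst DERIV_cong_ev) auto
  from DERIV_unique[OF tilted_moment_deriv[OF Suc.prems] this] show ?case
    using tilted_moment_0_pos[OF Suc.prems]
    by (simp add: V[OF Suc.prems] tilted_mean_def algebra_simps)
qed

text \<open>
  By the factorial bound on the moments, the integral of \<open>cosh (h * x) * exp (\<theta> * x)\<close> is dominated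
  by a geometric series of ratio \<open>\<bar>h\<bar> * C\<close>, and \<open>C\<close> depends only on \<open>V\<close> and the bound on
  the mean. The even function \<open>cosh\<close> is used since its Taylor coefficients against \<open>\<mu>\<close> involve only
  even moments, so that all terms are nonnegative and the sum and the integral may be
  interchanged without knowing integrability in advance.
\<close>

lemma Theta_uniform_margin:
  assumes V: "\<And>\<theta>. \<theta> \<in> Theta \<mu> \<Longrightarrow> tilted_variance \<theta> = poly V (tilted_mean \<theta>)"
  obtains \<delta> where "\<delta> > 0" "\<And>\<theta>. \<theta> \<in> Theta \<mu> \<Longrightarrow> \<bar>tilted_mean \<theta>\<bar> \<le> M \<Longrightarrow> ball \<theta> \<delta> \<subseteq> Theta \<mu>"
proof -
  define B where "B = max 1 M"
  define C where "C = B + poly_abs B V * (degree V + 1)"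
  have "poly_abs B V \<ge> 0"
    by (intro poly_abs_nonneg) (simp add: B_def)
  moreover have "B \<ge> 1"
    by (simp add: B_def)
  ultimately have C: "C > 0"
    by (simp add: C_def add_pos_nonneg)
  have "ball \<theta> (1 / C) \<subseteq> Theta \<mu>" if \<theta>: "\<theta> \<in> Theta \<mu>" and M: "\<bar>tilted_mean \<theta>\<bar> \<le> M" for \<theta>
    unfolding Theta_def
  proof (rule interior_maximal)
    have bound: "\<bar>tilted_moment n \<theta>\<bar> \<le> tilted_moment 0 \<theta> * (fact n * C ^ n)" for n
    proof -
      have "\<bar>poly (moment_poly V n) (tilted_mean \<theta>)\<bar> \<le> poly_abs B (moment_poly V n)"
        using M by (intro abs_poly_le_poly_abs) (simp add: B_def)
      also have "\<dots> \<le> fact n * C ^ n"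
        unfolding C_def by (rule poly_abs_moment_poly) (simp add: B_def)
      finally show ?thesis
        using tilted_moment_0_pos[OF \<theta>] tilted_moment_eq_moment_poly[OF V \<theta>, of n]
        by (simp add: abs_mult mult_left_mono)
    qed
    show "ball \<theta> (1 / C) \<subseteq> {\<theta>. laplace \<mu> \<theta> < \<infinity>}"
    proof safe
      fix \<theta>' assume "\<theta>' \<in> ball \<theta> (1 / C)"
      define h where "h = \<theta>' - \<theta>"
      have h: "\<bar>h\<bar> * C < 1"
        using \<open>\<theta>' \<in> ball \<theta> (1 / C)\<close> C by (simp add: h_def dist_real_def field_simps abs_minus_commute)
      define f where "f n x = (if even n then (h * x) ^ n / fact n else 0) * exp (\<theta> * x)" for n x
      have f_nonneg: "f n x \<ge> 0" for n x
        unfolding f_def by (intro mult_nonneg_nonneg) (simp_all add: zero_le_even_power)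
      have f_sums: "(\<lambda>n. f n x) sums (cosh (h * x) * exp (\<theta> * x))" for x
        unfolding f_def by (intro sums_mult2) (use cosh_converges[of "h * x"] in \<open>simp add: divide_inverse mult.commute if_distrib cong: if_cong\<close>)
      have f_int: "(\<integral>\<^sup>+ x. ennreal (f n x) \<partial>\<mu>) \<le> ennreal (tilted_moment 0 \<theta> * (\<bar>h\<bar> * C) ^ n)" for n
      proof (cases "even n")
        case True
        have f_eq: "f n = (\<lambda>x. (h ^ n / fact n) * (x ^ n * exp (\<theta> * x)))"
          using True by (auto simp: f_def power_mult_distrib)
        have "integrable \<mu> (f n)"
          unfolding f_eq by (intro integrable_mult_right integrable_power_exp \<theta>)
        then have "(\<integral>\<^sup>+ x. ennreal (f n x) \<partial>\<mu>) = ennreal (LINT x|\<mu>. f n x)"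
          using f_nonneg by (intro nn_integral_eq_integral) auto
        also have "(LINT x|\<mu>. f n x) = h ^ n / fact n * tilted_moment n \<theta>"
          by (simp add: f_eq tilted_moment_def)
        also have "\<dots> \<le> \<bar>h ^ n / fact n * tilted_moment n \<theta>\<bar>"
          by (rule abs_ge_self)
        also have "\<dots> = \<bar>h\<bar> ^ n / fact n * \<bar>tilted_moment n \<theta>\<bar>"
          by (simp add: abs_mult power_abs)
        also have "\<dots> \<le> \<bar>h\<bar> ^ n / fact n * (tilted_moment 0 \<theta> * (fact n * C ^ n))"
          using bound by (intro mult_left_mono) auto
        also have "\<dots> = tilted_moment 0 \<theta> * (\<bar>h\<bar> * C) ^ n"
          by (simp add: power_mult_distrib)
        finally show ?thesis
          using ennreal_leI by blast
      qed (simp add: f_def)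
      have "laplace \<mu> \<theta>' \<le> (\<integral>\<^sup>+ x. (\<Sum>n. 2 * ennreal (f n x)) \<partial>\<mu>)"
        unfolding laplace_def
      proof (rule nn_integral_mono)
        fix x
        have "exp (h * x) \<le> 2 * cosh (h * x)"
          by (simp add: cosh_def)
        then have "exp (h * x) * exp (\<theta> * x) \<le> 2 * cosh (h * x) * exp (\<theta> * x)"
          by (intro mult_right_mono) auto
        then have "ennreal (exp (\<theta>' * x)) \<le> ennreal (2 * (\<Sum>n. f n x))"
          using f_sums[of x] by (intro ennreal_leI) (simp add: h_def sums_iff algebra_simps flip: exp_add)
        also have "\<dots> = (\<Sum>n. 2 * ennreal (f n x))"
          using f_sums[of x] f_nonneg
          by (simp add: ennreal_mult suminf_nonneg sums_iff suminf_ennreal2)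
        finally show "ennreal (exp (\<theta>' * x)) \<le> (\<Sum>n. 2 * ennreal (f n x))" .
      qed
      also have "\<dots> = (\<Sum>n. 2 * (\<integral>\<^sup>+ x. ennreal (f n x) \<partial>\<mu>))"
        unfolding f_def by (simp add: nn_integral_suminf nn_integral_cmult)
      also have "\<dots> \<le> (\<Sum>n. 2 * ennreal (tilted_moment 0 \<theta> * (\<bar>h\<bar> * C) ^ n))"
        by (intro suminf_le mult_left_mono f_int) auto
      also have "\<dots> = 2 * ennreal (\<Sum>n. tilted_moment 0 \<theta> * (\<bar>h\<bar> * C) ^ n)"
        using tilted_moment_0_pos[OF \<theta>] C h
        by (simp add: suminf_ennreal2 summable_geometric abs_mult less_imp_le)
      also have "\<dots> < \<infinity>"
        by (simp add: ennreal_mult_less_top)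
      finally show "laplace \<mu> \<theta>' < \<infinity>" .
    qed
  qed simp
  with C show ?thesis
    by (intro that[of "1 / C"]) auto
qed

text \<open>
  The points near which the relations hold form a clopen set. To see closedness at a point \<open>z\<close>, let
  \<open>y\<close> be a point of the set so close to \<open>z\<close> that \<open>a z\<close> lies within the uniform
  margin around \<open>a y\<close>. Thus \<open>a z \<in> Theta \<mu>\<close>, both sides of the relations are analytic near \<open>z\<close>, and
  the identity theorem applies.
\<close>

lemma relations_extend:
  assumes form: "exponential_form Q r a b"
    and V: "\<And>\<theta>. \<theta> \<in> Theta \<mu> \<Longrightarrow> tilted_variance \<theta> = poly V (tilted_mean \<theta>)"
    and rel: "eventually (\<lambda>z. a z \<in> Theta \<mu> \<and> exp (b z) * tilted_moment 0 (a z) = 1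
      \<and> tilted_mean (a z) = t * z + tilted_mean 0) (nhds 0)"
    and z: "z \<in> {-r<..<r}"
  shows "a z \<in> Theta \<mu> \<and> exp (b z) * tilted_moment 0 (a z) = 1 \<and> tilted_mean (a z) = t * z + tilted_mean 0"
proof -
  define R where "R z \<longleftrightarrow> a z \<in> Theta \<mu> \<and> exp (b z) * tilted_moment 0 (a z) = 1 \<and> tilted_mean (a z) = t * z + tilted_mean 0" for z
  define Z where "Z = {z \<in> {-r<..<r}. eventually R (nhds z)}"
  have a: "real_analytic_on a {-r<..<r}" and b: "real_analytic_on b {-r<..<r}" and r: "r > 0"
    using form by (auto simp: exponential_form_def)
  obtain \<delta> where \<delta>: "\<delta> > 0"
    "\<And>\<theta>. \<theta> \<in> Theta \<mu> \<Longrightarrow> \<bar>tilted_mean \<theta>\<bar> \<le> \<bar>t\<bar> * r + \<bar>tilted_mean 0\<bar> \<Longrightarrow> ball \<theta> \<delta> \<subseteq> Theta \<mu>"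
    using Theta_uniform_margin[OF V] by blast
  have "open Z"
    unfolding open_subopen[of Z]
  proof
    fix z assume "z \<in> Z"
    then have z: "z \<in> {-r<..<r}" "eventually R (nhds z)"
      by (auto simp: Z_def)
    from eventually_nhds_in_open[OF open_greaterThanLessThan z(1)] z(2)[folded eventually_eventually[of R z]]
    have "eventually (\<lambda>w. w \<in> Z) (nhds z)"
      by eventually_elim (simp add: Z_def)
    then show "\<exists>T. open T \<and> z \<in> T \<and> T \<subseteq> Z"
      by (auto simp: eventually_nhds)
  qed
  then have "openin (top_of_set {-r<..<r}) Z"
    by (auto simp: openin_open_eq Z_def)
  moreover have "closedin (top_of_set {-r<..<r}) Z"
    unfolding closedin_limpt
  proof (intro conjI allI impI)
    fix z assume "z islimpt Z \<and> z \<in> {-r<..<r}"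
    then have lim: "z islimpt Z" and z: "z \<in> {-r<..<r}" by auto
    have freq: "frequently (\<lambda>y. y \<in> Z \<and> R y) (at z)"
      using lim unfolding islimpt_conv_frequently_at
      by (rule frequently_elim1) (auto simp: Z_def dest: eventually_nhds_x_imp_x)
    have cont: "(a \<longlongrightarrow> a z) (at z)"
      using real_analytic_on_imp_isCont[OF a z] by (simp add: isCont_def)
    have "eventually (\<lambda>y. dist (a y) (a z) < \<delta>) (at z)"
      using cont \<delta>(1) by (rule tendstoD)
    with freq have "frequently (\<lambda>y. (y \<in> Z \<and> R y) \<and> dist (a y) (a z) < \<delta>) (at z)"
      by (rule frequently_eventually_frequently)
    then obtain y where y: "y \<in> Z" "R y" "dist (a y) (a z) < \<delta>"
      by (auto dest: frequently_ex)
    have "\<bar>tilted_mean (a y)\<bar> \<le> \<bar>t\<bar> * r + \<bar>tilted_mean 0\<bar>"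
    proof -
      have "\<bar>y\<bar> \<le> r"
        using y(1) by (auto simp: Z_def)
      then have "\<bar>t * y\<bar> \<le> \<bar>t\<bar> * r"
        by (simp add: abs_mult mult_left_mono)
      then show ?thesis
        using y(2) abs_triangle_ineq[of "t * y" "tilted_mean 0"] by (simp add: R_def)
    qed
    then have az: "a z \<in> Theta \<mu>"
      using \<delta>(2)[of "a y"] y by (auto simp: R_def)
    have "real_analytic_on a {z}" and "real_analytic_on b {z}"
      using a b z by (auto elim!: real_analytic_on_subset)
    then have comp: "real_analytic_on (\<lambda>y. exp (b y)) {z}" "real_analytic_on (\<lambda>y. tilted_moment j (a y)) {z}" for j
      using az by (auto intro!: real_analytic_on_compose[of exp] real_analytic_on_compose[of "tilted_moment j" a]
        real_analytic_on_exp intro: real_analytic_on_subset[OF tilted_moment_analytic])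
    have "eventually (\<lambda>y. exp (b y) * tilted_moment 0 (a y) - 1 = 0) (nhds z)"
    proof (rule real_analytic_frequently_zero)
      show "frequently (\<lambda>y. exp (b y) * tilted_moment 0 (a y) - 1 = 0) (at z)"
        using freq by (rule frequently_elim1) (simp add: R_def)
    qed (intro real_analytic_on_diff real_analytic_on_mult comp real_analytic_on_const)
    moreover have "eventually (\<lambda>y. exp (b y) * tilted_moment 1 (a y) - (t * y + tilted_mean 0) = 0) (nhds z)"
    proof (rule real_analytic_frequently_zero)
      show "frequently (\<lambda>y. exp (b y) * tilted_moment 1 (a y) - (t * y + tilted_mean 0) = 0) (at z)"
        using freq
      proof (rule frequently_elim1)
        fix y assume y: "y \<in> Z \<and> R y"
        then have "tilted_moment 1 (a y) = tilted_moment 0 (a y) * (t * y + tilted_mean 0)"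
          using tilted_moment_0_pos[of "a y"] by (simp add: R_def tilted_mean_def[of "a y"] field_simps)
        then show "exp (b y) * tilted_moment 1 (a y) - (t * y + tilted_mean 0) = 0"
          using y by (simp add: R_def flip: mult.assoc)
      qed
    qed (intro real_analytic_on_diff real_analytic_on_add real_analytic_on_mult comp
        real_analytic_on_const real_analytic_on_ident)
    moreover have "eventually (\<lambda>y. a y \<in> Theta \<mu>) (nhds z)"
    proof -
      have "filterlim a (nhds (a z)) (nhds z)"
        using cont tendsto_at_iff_tendsto_nhds[of a z] by simp
      from eventually_compose_filterlim[OF eventually_nhds_in_open[OF open_Theta az] this]
      show ?thesis .
    qed
    ultimately have "eventually R (nhds z)"
    proof eventually_elim
      case (elim y)
      then have "tilted_moment 0 (a y) > 0" "exp (b y) = 1 / tilted_moment 0 (a y)"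
        using tilted_moment_0_pos[of "a y"] by (auto simp: field_simps)
      with elim show ?case
        by (simp add: R_def tilted_mean_def[of "a y"])
    qed
    with z show "z \<in> Z"
      by (simp add: Z_def)
  qed (auto simp: Z_def)
  moreover have "0 \<in> Z"
    using rel r by (simp add: Z_def R_def[abs_def])
  ultimately have "Z = {-r<..<r}"
    using connected_Ioo[of "-r" r] unfolding connected_clopen by blast
  with z have "z \<in> Z"
    by simp
  then have "eventually R (nhds z)"
    unfolding Z_def by blast
  from eventually_nhds_x_imp_x[OF this] show ?thesis
    by (simp add: R_def)
qed

end

section \<open>The density in the mean parametrization\<close>

context nef_generator
begin

lemma psi_analytic: "real_analytic_on (psi \<mu>) {tilted_mean 0}"
proof (rule real_analytic_local_inverse[where f = tilted_mean and x = 0])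
  show "real_analytic_on tilted_mean {0}"
    using tilted_mean_analytic by (rule real_analytic_on_subset) (use zero_in_Theta in auto)
  show "(tilted_mean has_real_derivative tilted_variance 0) (at 0)"
    by (rule tilted_mean_deriv[OF zero_in_Theta])
  show "tilted_variance 0 \<noteq> 0"
    using tilted_variance_pos[OF zero_in_Theta] by simp
  show "psi \<mu> (tilted_mean 0) = 0"
    by (rule psi_tilted_mean[OF zero_in_Theta])
  obtain \<delta> where \<delta>: "\<delta> > 0" "\<And>h. \<bar>h\<bar> \<le> \<delta> \<Longrightarrow> h \<in> Theta \<mu>"
    using Theta_margin[OF zero_in_Theta] by (metis add_0)
  have cont: "isCont tilted_mean \<theta>" if "\<theta> \<in> Theta \<mu>" for \<theta>
    using tilted_mean_deriv[OF that] by (rule DERIV_isCont)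
  show "isCont (psi \<mu>) (tilted_mean 0)"
    by (rule isCont_inverse_function[where d = \<delta>]) (use \<delta> psi_tilted_mean cont in auto)
  have "tilted_mean (- \<delta>) < tilted_mean 0" "tilted_mean 0 < tilted_mean \<delta>"
    using \<delta> by (auto intro!: tilted_mean_strict_mono zero_in_Theta)
  then have "eventually (\<lambda>y. y \<in> {tilted_mean (- \<delta>)<..<tilted_mean \<delta>}) (nhds (tilted_mean 0))"
    by (intro eventually_nhds_in_open) auto
  then show "eventually (\<lambda>y. tilted_mean (psi \<mu> y) = y) (nhds (tilted_mean 0))"
  proof eventually_elim
    case (elim y)
    then obtain \<theta> where \<theta>: "- \<delta> \<le> \<theta>" "\<theta> \<le> \<delta>" "tilted_mean \<theta> = y"
      using IVT[of tilted_mean "- \<delta>" y \<delta>] \<delta> cont by fastforce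
    then show ?case
      using psi_tilted_mean[of \<theta>] \<delta>(2)[of \<theta>] by auto
  qed
qed

lemma nef_density_of_relation:
  assumes "a \<in> Theta \<mu>" "exp b * tilted_moment 0 a = 1" "tilted_mean a = m"
  shows "psi \<mu> m = a" "cumulant \<mu> a = - b" "nef_density \<mu> x m = exp (a * x + b)"
proof -
  show psi: "psi \<mu> m = a"
    using psi_tilted_mean[OF assms(1)] assms(3) by simp
  have "tilted_moment 0 a = exp (- b)"
    using assms(2) by (simp add: exp_minus field_simps)
  then show cum: "cumulant \<mu> a = - b"
    by (simp add: cumulant_eq[OF assms(1)])
  show "nef_density \<mu> x m = exp (a * x + b)"
    by (simp add: nef_density_def psi cum)
qed

lemma exponential_form_imp_nef_poly:
  assumes form: "exponential_form Q r a b" and t: "t \<noteq> 0"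
    and rel: "eventually (\<lambda>z. a z \<in> Theta \<mu> \<and> exp (b z) * tilted_moment 0 (a z) = 1
      \<and> tilted_mean (a z) = t * z + m) (nhds 0)"
  shows "poly (Q n) x = t ^ n * nef_poly \<mu> m n x"
proof -
  have "eventually (\<lambda>z. z \<in> {-r<..<r}) (nhds 0)"
    using form by (intro eventually_nhds_in_open) (auto simp: exponential_form_def)
  then have "eventually (\<lambda>z. (\<lambda>n. poly (Q n) x / fact n * z ^ n) sums nef_density \<mu> x (t * z + m)) (nhds 0)"
    using rel
  proof eventually_elim
    case (elim z)
    then have "(\<lambda>n. poly (Q n) x * (z ^ n / fact n)) sums exp (a z * x + b z)"
      using form by (simp add: exponential_form_def)
    then show ?case
      using nef_density_of_relation(3)[of "a z" "b z" "t * z + m" x] elim by simp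
  qed
  from higher_deriv_eq_scaled_coefficient[OF t this, of n] show ?thesis
    by (simp add: nef_poly_def)
qed

text \<open>
  With \<open>a z = psi \<mu> (t * z + tilted_mean 0)\<close> and \<open>b z = - cumulant \<mu> (a z)\<close>, the exponential is the density
  of the family at the mean \<open>t * z + tilted_mean 0\<close>. Its Taylor coefficients in \<open>z\<close> are \<open>t ^ n\<close> times the
  derivatives that define \<open>nef_poly\<close>.
\<close>

lemma nef_poly_imp_exponential:
  assumes t: "t \<noteq> 0" and Q: "\<And>n x. poly (Q n) x = t ^ n * nef_poly \<mu> (tilted_mean 0) n x"
  shows "exponential_generating_function Q"
proof -
  define a where "a z = psi \<mu> (t * z + tilted_mean 0)" for z
  define b where "b z = - cumulant \<mu> (a z)" for z
  have a: "real_analytic_on a {0}"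
    unfolding a_def
  proof (rule real_analytic_on_compose[of "psi \<mu>"])
    show "real_analytic_on (psi \<mu>) ((\<lambda>z. t * z + tilted_mean 0) ` {0})"
      using psi_analytic by simp
  qed (intro real_analytic_on_add real_analytic_on_mult real_analytic_on_const real_analytic_on_ident)
  have "a 0 = 0"
    using psi_tilted_mean[OF zero_in_Theta] by (simp add: a_def)
  then have "real_analytic_on (\<lambda>z. cumulant \<mu> (a z)) {0}"
    using zero_in_Theta by (intro real_analytic_on_compose[of "cumulant \<mu>" a] a real_analytic_on_subset[OF cumulant_analytic]) auto
  from real_analytic_on_diff[OF real_analytic_on_const[of 0] this] have b: "real_analytic_on b {0}"
    by (simp add: b_def[abs_def])
  obtain \<rho> where \<rho>: "\<rho> > 0" "real_analytic_on a {-\<rho><..<\<rho>}" "real_analytic_on b {-\<rho><..<\<rho>}"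
    "\<And>x. \<exists>c. \<forall>z\<in>{-\<rho><..<\<rho>}. (\<lambda>n. c n * z ^ n) sums exp (a z * x + b z)"
    using exponential_has_uniform_power_series[OF a b] by metis
  have "(\<lambda>n. poly (Q n) x * (z ^ n / fact n)) sums exp (a z * x + b z)" if z: "z \<in> {-\<rho><..<\<rho>}" for z x
  proof -
    obtain c where c: "\<And>z. z \<in> {-\<rho><..<\<rho>} \<Longrightarrow> (\<lambda>n. c n * z ^ n) sums exp (a z * x + b z)"
      using \<rho>(4)[of x] by blast
    have dens: "exp (a z * x + b z) = nef_density \<mu> x (t * z + tilted_mean 0)" for z
      by (simp add: nef_density_def a_def b_def)
    have "eventually (\<lambda>z. z \<in> {-\<rho><..<\<rho>}) (nhds 0)"
      using \<rho>(1) by (intro eventually_nhds_in_open) auto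
    then have "eventually (\<lambda>z. (\<lambda>n. c n * z ^ n) sums nef_density \<mu> x (t * z + tilted_mean 0)) (nhds 0)"
      by (rule eventually_mono) (use c dens in simp)
    from higher_deriv_eq_scaled_coefficient[OF t this]
    have "poly (Q n) x = fact n * c n" for n
      by (simp add: Q nef_poly_def)
    then show ?thesis
      using c[OF z] by simp
  qed
  with \<rho> have "exponential_form Q \<rho> a b"
    by (simp add: exponential_form_def)
  then show ?thesis
    unfolding exponential_generating_function_def by blast
qed

end

text \<open>
  Passing from the generator \<open>\<nu>\<close> to the member of parameter \<open>\<theta>\<close> translates the domain of the
  Laplace transform by \<open>\<theta>\<close>, multiplies the transform by a constant, and preserves null sets.
\<close>

lemma nef_generator_nef_member:
  assumes F: "natural_exponential_family F" and \<mu>: "\<mu> \<in> F"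
  shows "nef_generator \<mu>"
proof -
  obtain \<nu> where \<nu>: "in_M \<nu>" "F = nef_generated \<nu>"
    using F unfolding natural_exponential_family_def by blast
  then obtain \<theta> where \<theta>: "\<theta> \<in> Theta \<nu>" "\<mu> = nef_member \<theta> \<nu>"
    using \<mu> unfolding \<nu>(2) nef_generated_def by blast
  have [measurable_cong]: "sets \<nu> = sets borel"
    using \<nu>(1) by (simp add: in_M_def radon_def)
  define k where "k = cumulant \<nu> \<theta>"
  have \<mu>_eq: "\<mu> = density \<nu> (\<lambda>x. ennreal (exp (\<theta> * x - k)))"
    by (simp add: \<theta>(2) nef_member_def k_def)
  have sets: "sets \<mu> = sets borel"
    by (simp add: \<mu>_eq \<open>sets \<nu> = sets borel\<close>)
  have laplace: "laplace \<mu> \<eta> = ennreal (exp (- k)) * laplace \<nu> (\<theta> + \<eta>)" for \<eta>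
  proof -
    have "laplace \<mu> \<eta> = (\<integral>\<^sup>+ x. ennreal (exp (\<theta> * x - k)) * ennreal (exp (\<eta> * x)) \<partial>\<nu>)"
      unfolding laplace_def \<mu>_eq by (rule nn_integral_density) measurable
    also have "\<dots> = (\<integral>\<^sup>+ x. ennreal (exp (- k)) * ennreal (exp ((\<theta> + \<eta>) * x)) \<partial>\<nu>)"
      by (intro nn_integral_cong) (simp add: algebra_simps flip: ennreal_mult exp_add)
    also have "\<dots> = ennreal (exp (- k)) * laplace \<nu> (\<theta> + \<eta>)"
      unfolding laplace_def by (rule nn_integral_cmult) measurable
    finally show ?thesis .
  qed
  have AE_iff: "(AE x in \<mu>. P x) \<longleftrightarrow> (AE x in \<nu>. P x)" for P
    unfolding \<mu>_eq by (subst AE_density) auto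
  have "laplace \<nu> \<theta> \<noteq> 0"
  proof
    assume "laplace \<nu> \<theta> = 0"
    then have "AE x in \<nu>. ennreal (exp (\<theta> * x)) = 0"
      unfolding laplace_def by (subst (asm) nn_integral_0_iff_AE) auto
    then have "AE x in \<nu>. x = 0"
      by eventually_elim simp
    with \<nu>(1) show False
      by (auto simp: in_M_def)
  qed
  moreover have "laplace \<nu> \<theta> < \<infinity>"
    using \<theta>(1) Theta_subset by blast
  ultimately obtain l where l: "l > 0" "laplace \<nu> \<theta> = ennreal l"
    by (cases "laplace \<nu> \<theta>") (auto simp: le_less)
  then have "exp (- k) * l = 1"
    by (simp add: k_def cumulant_def exp_minus)
  then have mass: "laplace \<mu> 0 = 1"
    using l by (simp add: laplace flip: ennreal_mult)
  show ?thesis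
  proof
    show "sets \<mu> = sets borel"
      by (rule sets)
    show "emeasure \<mu> (space \<mu>) = 1"
      using mass by (simp add: laplace_def)
    show "\<not> (\<exists>c. AE x in \<mu>. x = c)"
      using \<nu>(1) by (simp add: AE_iff in_M_def)
    obtain e where e: "e > 0" "ball \<theta> e \<subseteq> Theta \<nu>"
      using open_Theta \<theta>(1) open_contains_ball by blast
    have "ball 0 e \<subseteq> {\<eta>. laplace \<mu> \<eta> < \<infinity>}"
    proof safe
      fix \<eta> :: real assume "\<eta> \<in> ball 0 e"
      then have "\<theta> + \<eta> \<in> Theta \<nu>"
        using e(2) by (auto simp: dist_real_def)
      then have "laplace \<nu> (\<theta> + \<eta>) < \<infinity>"
        using Theta_subset by blast
      then show "laplace \<mu> \<eta> < \<infinity>"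
        by (simp add: laplace ennreal_mult_less_top)
    qed
    then have "ball 0 e \<subseteq> Theta \<mu>"
      unfolding Theta_def by (rule interior_maximal) simp
    with e(1) show "0 \<in> Theta \<mu>"
      by auto
  qed
qed

section \<open>The characterization\<close>

theorem theorem4p1:
  fixes F :: "real measure set" and \<mu> :: "real measure" and m\<^sub>o :: real
    and Q :: "nat \<Rightarrow> real poly"
  assumes "natural_exponential_family F"
    and "\<mu> \<in> F"
    and "has_bochner_integral \<mu> (\<lambda>x. x) m\<^sub>o"
    and "two_orthogonal \<mu> Q"
    and "\<forall>n. degree (Q n) = n"
    and "Q 0 = 1"
  shows "(exponential_generating_function Q \<longleftrightarrow>
            (\<exists>t. t \<noteq> 0 \<and> (\<forall>n x. poly (Q n) x = t ^ n * nef_poly \<mu> m\<^sub>o n x))) \<and>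
         (\<forall>t r a b. t \<noteq> 0 \<and> (\<forall>n x. poly (Q n) x = t ^ n * nef_poly \<mu> m\<^sub>o n x) \<and>
            exponential_form Q r a b \<longrightarrow>
            (\<forall>z\<in>{-r<..<r}. t * z + m\<^sub>o \<in> means_domain \<mu> \<and>
               a z = psi \<mu> (t * z + m\<^sub>o) \<and> b z = - cumulant \<mu> (a z)))"
proof -
  interpret nef_generator \<mu>
    using assms(1,2) by (rule nef_generator_nef_member)
  have m: "tilted_mean 0 = m\<^sub>o"
    using assms(3) by (rule tilted_mean_zero)
  have deg: "\<And>n. degree (Q n) = n"
    using assms(5) by simp
  show ?thesis
  proof (intro conjI iffI allI impI)
    assume "exponential_generating_function Q"
    then obtain r a b where form: "exponential_form Q r a b"
      unfolding exponential_generating_function_def by blast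
    from exponential_form_relations[OF form assms(6,4) deg]
    obtain t V where t: "t \<noteq> 0" and rel: "eventually (\<lambda>z. a z \<in> Theta \<mu> \<and> exp (b z) * tilted_moment 0 (a z) = 1
      \<and> tilted_mean (a z) = t * z + tilted_mean 0 \<and> tilted_variance (a z) = poly V (t * z + tilted_mean 0)) (nhds 0)" .
    have "eventually (\<lambda>z. a z \<in> Theta \<mu> \<and> exp (b z) * tilted_moment 0 (a z) = 1 \<and> tilted_mean (a z) = t * z + m\<^sub>o) (nhds 0)"
      using rel by eventually_elim (simp add: m)
    from exponential_form_imp_nef_poly[OF form t this] t
    show "\<exists>t. t \<noteq> 0 \<and> (\<forall>n x. poly (Q n) x = t ^ n * nef_poly \<mu> m\<^sub>o n x)"
      by blast
  next
    assume "\<exists>t. t \<noteq> 0 \<and> (\<forall>n x. poly (Q n) x = t ^ n * nef_poly \<mu> m\<^sub>o n x)"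
    then show "exponential_generating_function Q"
      using nef_poly_imp_exponential unfolding m by blast
  next
    fix t r a b
    assume asm: "t \<noteq> 0 \<and> (\<forall>n x. poly (Q n) x = t ^ n * nef_poly \<mu> m\<^sub>o n x) \<and> exponential_form Q r a b"
    then have form: "exponential_form Q r a b" by blast
    from exponential_form_relations[OF form assms(6,4) deg]
    obtain s V where s: "s \<noteq> 0" and rel: "eventually (\<lambda>z. a z \<in> Theta \<mu> \<and> exp (b z) * tilted_moment 0 (a z) = 1
      \<and> tilted_mean (a z) = s * z + tilted_mean 0 \<and> tilted_variance (a z) = poly V (s * z + tilted_mean 0)) (nhds 0)" .
    have rel': "eventually (\<lambda>z. a z \<in> Theta \<mu> \<and> exp (b z) * tilted_moment 0 (a z) = 1 \<and> tilted_mean (a z) = s * z + tilted_mean 0) (nhds 0)"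
      using rel by eventually_elim simp
    \<comment> \<open>Both \<open>s\<close> and \<open>t\<close> are the ratio of \<open>Q 1\<close> to the first polynomial of the family.\<close>
    have "s = t"
    proof -
      have "Q 1 \<noteq> 0"
        using deg[of 1] by auto
      then obtain x where "poly (Q 1) x \<noteq> 0"
        using poly_all_0_iff_0 by blast
      moreover have "poly (Q 1) x = s ^ 1 * nef_poly \<mu> (tilted_mean 0) 1 x"
        by (rule exponential_form_imp_nef_poly[OF form s rel'])
      moreover have "poly (Q 1) x = t ^ 1 * nef_poly \<mu> m\<^sub>o 1 x"
        using asm by blast
      ultimately show ?thesis
        by (simp add: m)
    qed
    have "isCont a 0"
      using form by (intro real_analytic_on_imp_isCont[of a "{-r<..<r}"]) (auto simp: exponential_form_def)
    moreover have "a 0 = 0"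
      by (rule exponential_form_center[OF form assms(6)])
    moreover have "eventually (\<lambda>z. tilted_mean (a z) = s * z + tilted_mean 0 \<and> tilted_variance (a z) = poly V (s * z + tilted_mean 0)) (nhds 0)"
      using rel by eventually_elim simp
    ultimately have V: "tilted_variance \<theta> = poly V (tilted_mean \<theta>)" if "\<theta> \<in> Theta \<mu>" for \<theta>
      using variance_function_extends s that by blast
    show "\<forall>z\<in>{-r<..<r}. t * z + m\<^sub>o \<in> means_domain \<mu> \<and>
        a z = psi \<mu> (t * z + m\<^sub>o) \<and> b z = - cumulant \<mu> (a z)"
    proof
      fix z assume "z \<in> {-r<..<r}"
      from relations_extend[OF form V rel' this]
      have "a z \<in> Theta \<mu>" "exp (b z) * tilted_moment 0 (a z) = 1" "tilted_mean (a z) = t * z + m\<^sub>o"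
        by (simp_all add: m \<open>s = t\<close>)
      from nef_density_of_relation(1,2)[OF this] this(1,3)
      show "t * z + m\<^sub>o \<in> means_domain \<mu> \<and> a z = psi \<mu> (t * z + m\<^sub>o) \<and> b z = - cumulant \<mu> (a z)"
        unfolding means_domain_eq by (metis image_eqI minus_minus)
    qed
  qed
qed

end
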